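(* Let $G$ be an $(n,d,\lambda)$-colored graph with color set $D$. Let $T$ be a tree of $m$ vertices with edges colored by $D$. For any $U\subset V(G)$ with $|U|\ge m(m-1)\cdot\frac{\lambda n}{d}$, the number of disjoint copies of $T$ in $U$ is at least $$\frac{|U|}{m}-\frac{\lambda n}{d}.$$
   Context: An $(n,d,\lambda)$-graph is a finite undirected $d$-regular graph on $n$ vertices such that all eigenvalues of its adjacency matrix other than the trivial eigenvalue $d$ (one copy, belonging to the constant eigenvector) have absolute value at most $\lambda$. An $(n,d,\lambda)$-colored graph with color set $D$ is a graph whose edges are colored with $|D|$ colors (the elements of $D$) such that for each fixed color the (spanning) subgraph formed by the edges of that color is an $(n,d,\lambda)$-graph. A copy of the edge-colored tree $T$ in $U$ is a (not necessarily induced) subgraph of $G$ with all vertices in $U$ that is isomorphic to $T$ by an isomorphism preserving edge colors. "The number of disjoint copies of $T$ in $U$ is at least $x$" means that there is a family of at least $x$ pairwise vertex-disjoint copies of $T$ in $U$. *)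

theory Defs
  imports
    "Jordan_Normal_Form.Char_Poly"
    "HOL-Computational_Algebra.Fundamental_Theorem_Algebra"
begin

definition simple_graph :: "'v set \<Rightarrow> 'v set set \<Rightarrow> bool" where
  "simple_graph V E \<longleftrightarrow> finite V \<and> (\<forall>e\<in>E. e \<subseteq> V \<and> card e = 2)"

definition regular_graph :: "'v set \<Rightarrow> 'v set set \<Rightarrow> nat \<Rightarrow> bool" where
  "regular_graph V E d \<longleftrightarrow> simple_graph V E \<and> (\<forall>v\<in>V. card {e\<in>E. v \<in> e} = d)"

(* vs is an enumeration of the vertices. The diagonal is 0 for a simple graph, as {v, v} = {v} is
   not an edge. *)
definition adjacency_matrix :: "'v list \<Rightarrow> 'v set set \<Rightarrow> complex mat" where
  "adjacency_matrix vs E =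
     mat (length vs) (length vs) (\<lambda>(i, j). if {vs ! i, vs ! j} \<in> E then 1 else 0)"

(* The multiset of complex roots of the characteristic polynomial is the multiset of eigenvalues,
   with multiplicity; one copy of the eigenvalue d is removed from it. The choice of the
   enumeration vs is immaterial, since reordering the vertices conjugates the adjacency matrix by
   a permutation matrix. *)
definition ndl_graph :: "'v set \<Rightarrow> 'v set set \<Rightarrow> nat \<Rightarrow> nat \<Rightarrow> real \<Rightarrow> bool" where
  "ndl_graph V E n d l \<longleftrightarrow>
     regular_graph V E d \<and> card V = n \<and>
     (\<exists>vs. distinct vs \<and> set vs = V \<and>
        (\<forall>\<mu>. \<mu> \<in># proots (char_poly (adjacency_matrix vs E)) - {#of_nat d#} \<longrightarrow> cmod \<mu> \<le> l))"

definition edge_colored_graph ::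
    "'v set \<Rightarrow> 'v set set \<Rightarrow> ('v set \<Rightarrow> 'c) \<Rightarrow> 'c set \<Rightarrow> bool" where
  "edge_colored_graph V E c D \<longleftrightarrow> simple_graph V E \<and> (\<forall>e\<in>E. c e \<in> D)"

definition ndl_colored_graph ::
    "'v set \<Rightarrow> 'v set set \<Rightarrow> ('v set \<Rightarrow> 'c) \<Rightarrow> 'c set \<Rightarrow> nat \<Rightarrow> nat \<Rightarrow> real \<Rightarrow> bool" where
  "ndl_colored_graph V E c D n d l \<longleftrightarrow>
     edge_colored_graph V E c D \<and> card V = n \<and>
     (\<forall>k\<in>D. ndl_graph V {e\<in>E. c e = k} n d l)"

definition connected_graph :: "'v set \<Rightarrow> 'v set set \<Rightarrow> bool" where
  "connected_graph V E \<longleftrightarrow>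
     V \<noteq> {} \<and> (\<forall>u\<in>V. \<forall>v\<in>V. (u, v) \<in> {(x, y). {x, y} \<in> E}\<^sup>*)"

definition is_cycle :: "'v set set \<Rightarrow> 'v list \<Rightarrow> bool" where
  "is_cycle E p \<longleftrightarrow>
     length p \<ge> 3 \<and> distinct p \<and> (\<forall>i<length p. {p ! i, p ! (Suc i mod length p)} \<in> E)"

definition tree_graph :: "'v set \<Rightarrow> 'v set set \<Rightarrow> bool" where
  "tree_graph V E \<longleftrightarrow> simple_graph V E \<and> connected_graph V E \<and> (\<nexists>p. is_cycle E p)"

(* (W, F) is a not necessarily induced subgraph, with vertex set W and edge set F, of the graph
   with edge set E colored by c; f is a color-preserving isomorphism onto it from the graph
   (VT, ET) with edge coloring cT. *)
definition copy_in ::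
    "'v set set \<Rightarrow> ('v set \<Rightarrow> 'c) \<Rightarrow> 't set \<Rightarrow> 't set set \<Rightarrow> ('t set \<Rightarrow> 'c) \<Rightarrow> 'v set
      \<Rightarrow> 'v set \<times> 'v set set \<Rightarrow> bool" where
  "copy_in E c VT ET cT U = (\<lambda>(W, F).
     W \<subseteq> U \<and> F \<subseteq> E \<and> (\<forall>e\<in>F. e \<subseteq> W) \<and>
     (\<exists>f. bij_betw f VT W \<and>
          (\<forall>x\<in>VT. \<forall>y\<in>VT. {x, y} \<in> ET \<longleftrightarrow> {f x, f y} \<in> F) \<and>
          (\<forall>x\<in>VT. \<forall>y\<in>VT. {x, y} \<in> ET \<longrightarrow> c {f x, f y} = cT {x, y})))"

definition disjoint_copies ::
    "'v set set \<Rightarrow> ('v set \<Rightarrow> 'c) \<Rightarrow> 't set \<Rightarrow> 't set set \<Rightarrow> ('t set \<Rightarrow> 'c) \<Rightarrow> 'v set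
      \<Rightarrow> ('v set \<times> 'v set set) set \<Rightarrow> bool" where
  "disjoint_copies E c VT ET cT U \<C> \<longleftrightarrow>
     (\<forall>H\<in>\<C>. copy_in E c VT ET cT U H) \<and> pairwise (\<lambda>H K. fst H \<inter> fst K = {}) \<C>"

end

(* Put mu = l n / d. A moment argument gives the mixing property: if no edge of a fixed color joins
   X and Y, then |X| |Y| <= mu^2. Indeed, for the adjacency matrix A of that color, the trace of
   A^(2k) is the sum of the (2k)-th powers of the eigenvalues, so on vectors y orthogonal to the
   constants |A^k y|^2 grows at most like l^(2k), and log-convexity of k |-> |A^k y|^2 turns this
   into |A y| <= l |y|.

   The tree is then grown one leaf at a time. Suppose there are r + x disjoint copies of the smaller
   tree, at least as many unused vertices in U, and (r + x)(x + 1) > mu^2. By Hall's theorem with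
   deficiency x and the mixing property, all but x of the copies can be extended by the new leaf.
   Unmatched copies are dissolved and their vertices return to the pool. For m >= 3 a suitable
   constant x leaves at least |U|/m - mu copies at the end. For m = 2, where the rounding is too
   tight, edges are chosen greedily. *)
theory Submission
  imports Defs "Jordan_Normal_Form.Schur_Decomposition" "HOL-Analysis.Convex"
begin

subsection \<open>Traces of matrix powers\<close>

lemma pow_upper_triangular:
  fixes B :: "'a::comm_ring_1 mat"
  assumes B: "B \<in> carrier_mat n n" and ut: "upper_triangular B"
  shows "upper_triangular (B ^\<^sub>m k)" and "i < n \<Longrightarrow> (B ^\<^sub>m k) $$ (i, i) = (B $$ (i, i)) ^ k"
proof -
  have "upper_triangular (B ^\<^sub>m k) \<and> (\<forall>i<n. (B ^\<^sub>m k) $$ (i, i) = (B $$ (i, i)) ^ k)"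
  proof (induction k)
    case 0
    then show ?case using B by auto
  next
    case (Suc k)
    let ?P = "B ^\<^sub>m k"
    have P: "?P \<in> carrier_mat n n" using B by simp
    have entry: "(?P * B) $$ (i, j) = (\<Sum>l<n. ?P $$ (i, l) * B $$ (l, j))" if "i < n" "j < n" for i j
      using that B P by (auto simp: scalar_prod_def atLeast0LessThan intro!: sum.cong)
    have P0: "?P $$ (i, l) = 0" if "l < i" "i < n" for i l
      using upper_triangularD[of ?P l i] Suc that P by auto
    have B0: "B $$ (i, l) = 0" if "l < i" "i < n" for i l
      using upper_triangularD[OF ut, of l i] that B by auto
    have "(?P * B) $$ (i, j) = 0" if "j < i" "i < n" for i j
    proof -
      have "?P $$ (i, l) * B $$ (l, j) = 0" if "l < n" for l
        using P0[of l i] B0[of j l] \<open>j < i\<close> \<open>i < n\<close> that by (cases "l < i") auto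
      then show ?thesis using entry[of i j] that by simp
    qed
    moreover have "(?P * B) $$ (i, i) = (B $$ (i, i)) ^ Suc k" if "i < n" for i
    proof -
      have "?P $$ (i, l) * B $$ (l, i) = (if l = i then (B $$ (i, i)) ^ Suc k else 0)" if "l < n" for l
      proof -
        consider "l < i" | "l = i" | "i < l" by linarith
        then show ?thesis
          using P0[of l i] B0[of i l] \<open>i < n\<close> that Suc by cases auto
      qed
      then have "(?P * B) $$ (i, i) = (\<Sum>l<n. if l = i then (B $$ (i, i)) ^ Suc k else 0)"
        using entry[of i i] that by simp
      then show ?thesis using that by simp
    qed
    ultimately show ?case using B by (auto intro!: upper_triangularI)
  qed
  then show "upper_triangular (B ^\<^sub>m k)" and "i < n \<Longrightarrow> (B ^\<^sub>m k) $$ (i, i) = (B $$ (i, i)) ^ k"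
    by auto
qed

lemma sum_diag_mult_commute:
  fixes M N :: "'a::comm_semiring_0 mat"
  assumes M: "M \<in> carrier_mat n n" and N: "N \<in> carrier_mat n n"
  shows "(\<Sum>i<n. (M * N) $$ (i, i)) = (\<Sum>i<n. (N * M) $$ (i, i))"
proof -
  have *: "(X * Y) $$ (i, i) = (\<Sum>l<n. X $$ (i, l) * Y $$ (l, i))"
    if "X \<in> carrier_mat n n" "Y \<in> carrier_mat n n" "i < n" for X Y :: "'a mat" and i
    using that by (auto simp: scalar_prod_def atLeast0LessThan intro!: sum.cong)
  have "(\<Sum>i<n. (M * N) $$ (i, i)) = (\<Sum>i<n. \<Sum>l<n. M $$ (i, l) * N $$ (l, i))"
    using *[OF M N] by simp
  also have "\<dots> = (\<Sum>l<n. \<Sum>i<n. N $$ (l, i) * M $$ (i, l))"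
    by (subst sum.swap) (simp add: mult.commute)
  also have "\<dots> = (\<Sum>i<n. (N * M) $$ (i, i))"
    using *[OF N M] by simp
  finally show ?thesis .
qed

lemma proots_prod_linear:
  "proots (\<Prod>a\<leftarrow>as. [:- a, 1 :: 'a::idom:]) = mset as"
proof (induction as)
  case (Cons a as)
  have "(\<Prod>a\<leftarrow>as. [:- a, 1:]) \<noteq> 0" by (auto simp: prod_list_zero_iff)
  then have "proots ([:- a, 1:] * (\<Prod>a\<leftarrow>as. [:- a, 1:])) = proots [:- a, 1:] + proots (\<Prod>a\<leftarrow>as. [:- a, 1:])"
    by (intro proots_mult) auto
  then show ?case unfolding list.map prod_list.Cons using Cons.IH by simp
qed simp

text \<open>Schur triangularization makes \<open>A\<close> similar to an upper triangular
  \<open>B\<close> whose diagonal lists the roots of the characteristic polynomial with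
  multiplicity. Powers respect the similarity, and cyclic invariance of the trace cancels the
  conjugating matrices.\<close>

lemma sum_diag_pow_eq_sum_proots:
  fixes A :: "complex mat"
  assumes A: "A \<in> carrier_mat n n"
  shows "(\<Sum>i<n. (A ^\<^sub>m k) $$ (i, i)) = (\<Sum>a\<in>#proots (char_poly A). a ^ k)"
    and "size (proots (char_poly A)) = n"
proof -
  obtain es where es: "char_poly A = (\<Prod>a\<leftarrow>es. [:- a, 1:])"
    using char_poly_factorized[OF A] by blast
  define B where "B = schur_upper_triangular A es"
  have B: "B \<in> carrier_mat n n" "upper_triangular B" "similar_mat A B"
    unfolding B_def by (rule schur_upper_triangular[OF A es])+
  obtain P Q where PQ: "similar_mat_wit A B P Q"
    using B(3) unfolding similar_mat_def by blast
  note W = similar_mat_witD2[OF A PQ]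
  have Bk: "B ^\<^sub>m k \<in> carrier_mat n n" using B by simp
  have roots: "proots (char_poly A) = mset (diag_mat B)"
    using char_poly_similar[OF B(3)] char_poly_upper_triangular[OF B(1,2)] proots_prod_linear by metis
  have "A ^\<^sub>m k = P * B ^\<^sub>m k * Q" by (rule similar_mat_wit_pow_id[OF PQ])
  also have "\<dots> = P * (B ^\<^sub>m k * Q)" by (rule assoc_mult_mat[OF W(6) Bk W(7)])
  finally have Ak: "A ^\<^sub>m k = P * (B ^\<^sub>m k * Q)" .
  have "(\<Sum>i<n. (A ^\<^sub>m k) $$ (i, i)) = (\<Sum>i<n. (B ^\<^sub>m k * Q * P) $$ (i, i))"
    unfolding Ak by (rule sum_diag_mult_commute[OF W(6) mult_carrier_mat[OF Bk W(7)]])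
  also have "B ^\<^sub>m k * Q * P = B ^\<^sub>m k"
    using assoc_mult_mat[OF Bk W(7,6)] W(2) right_mult_one_mat[OF Bk] by simp
  also have "(\<Sum>i<n. (B ^\<^sub>m k) $$ (i, i)) = (\<Sum>i<n. (B $$ (i, i)) ^ k)"
    using pow_upper_triangular(2)[OF B(1,2)] by simp
  also have "\<dots> = (\<Sum>a\<in>#mset (diag_mat B). a ^ k)"
    using B(1) unfolding mset_map[symmetric] sum_mset_sum_list
    by (simp add: diag_mat_def comp_def interv_sum_list_conv_sum_set_nat atLeast0LessThan)
  finally show "(\<Sum>i<n. (A ^\<^sub>m k) $$ (i, i)) = (\<Sum>a\<in>#proots (char_poly A). a ^ k)"
    by (simp add: roots)
  show "size (proots (char_poly A)) = n"
    using roots B(1) by (simp add: diag_mat_def)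
qed

subsection \<open>Mixing in regular graphs\<close>

text \<open>These are the entries of matrix powers, with rows and columns indexed by vertices and
  with real values. The estimates below thus avoid the enumeration of the vertices and complex
  scalars.\<close>

fun kernel_pow :: "'v set \<Rightarrow> ('v \<Rightarrow> 'v \<Rightarrow> real) \<Rightarrow> nat \<Rightarrow> 'v \<Rightarrow> 'v \<Rightarrow> real" where
  "kernel_pow V a 0 u v = of_bool (u = v)"
| "kernel_pow V a (Suc k) u v = (\<Sum>w\<in>V. kernel_pow V a k u w * a w v)"

lemma kernel_pow_add:
  assumes "finite V" "u \<in> V" "v \<in> V"
  shows "kernel_pow V a (j + k) u v = (\<Sum>w\<in>V. kernel_pow V a j u w * kernel_pow V a k w v)"
  using assms(3)
proof (induction k arbitrary: v)
  case 0
  have "(\<Sum>w\<in>V. kernel_pow V a j u w * kernel_pow V a 0 w v)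
      = (\<Sum>w\<in>V. if w = v then kernel_pow V a j u w else 0)"
    by (rule sum.cong) auto
  then show ?case using assms(1) 0 by simp
next
  case (Suc k)
  have "kernel_pow V a (j + Suc k) u v
      = (\<Sum>x\<in>V. (\<Sum>w\<in>V. kernel_pow V a j u w * kernel_pow V a k w x) * a x v)"
    using Suc.IH by simp
  also have "\<dots> = (\<Sum>x\<in>V. \<Sum>w\<in>V. kernel_pow V a j u w * (kernel_pow V a k w x * a x v))"
    by (simp add: sum_distrib_right mult.assoc)
  also have "\<dots> = (\<Sum>w\<in>V. kernel_pow V a j u w * kernel_pow V a (Suc k) w v)"
    by (subst sum.swap) (simp add: sum_distrib_left)
  finally show ?case .
qed

lemma kernel_pow_one:
  assumes "finite V" "u \<in> V" "v \<in> V"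
  shows "kernel_pow V a 1 u v = a u v"
proof -
  have "kernel_pow V a 1 u v = (\<Sum>w\<in>V. if w = u then a w v else 0)"
    by (auto intro: sum.cong)
  then show ?thesis using assms by simp
qed

lemma kernel_pow_Suc_left:
  assumes "finite V" "u \<in> V" "v \<in> V"
  shows "kernel_pow V a (Suc k) u v = (\<Sum>w\<in>V. a u w * kernel_pow V a k w v)"
proof -
  have "kernel_pow V a (1 + k) u v = (\<Sum>w\<in>V. kernel_pow V a 1 u w * kernel_pow V a k w v)"
    by (rule kernel_pow_add[OF assms])
  also have "\<dots> = (\<Sum>w\<in>V. a u w * kernel_pow V a k w v)"
    using kernel_pow_one[OF assms(1,2)] by simp
  finally show ?thesis by simp
qed

lemma kernel_pow_sym:
  assumes "finite V" and sym: "\<And>u v. a u v = a v u" and "u \<in> V" "v \<in> V"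
  shows "kernel_pow V a k u v = kernel_pow V a k v u"
  using assms(3,4)
proof (induction k arbitrary: u v)
  case (Suc k)
  have "kernel_pow V a (Suc k) u v = (\<Sum>w\<in>V. a v w * kernel_pow V a k w u)"
    using Suc sym by (auto intro!: sum.cong simp: mult.commute)
  then show ?case using kernel_pow_Suc_left[OF assms(1)] Suc.prems by metis
qed auto

lemma kernel_pow_row_sum:
  assumes "finite V" and rows: "\<And>u. u \<in> V \<Longrightarrow> (\<Sum>v\<in>V. a u v) = d" and "u \<in> V"
  shows "(\<Sum>v\<in>V. kernel_pow V a k u v) = d ^ k"
proof (induction k)
  case 0
  have "(\<Sum>v\<in>V. kernel_pow V a 0 u v) = (\<Sum>v\<in>V. if v = u then 1 else 0)"
    by (rule sum.cong) auto
  then show ?case using assms by simp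
next
  case (Suc k)
  have "(\<Sum>v\<in>V. kernel_pow V a (Suc k) u v) = (\<Sum>w\<in>V. kernel_pow V a k u w * (\<Sum>v\<in>V. a w v))"
    by (simp add: sum_distrib_left) (rule sum.swap)
  also have "\<dots> = (\<Sum>w\<in>V. kernel_pow V a k u w * d)" using rows by simp
  also have "\<dots> = d ^ Suc k"
    by (simp only: sum_distrib_right[symmetric] Suc.IH power_Suc2)
  finally show ?case .
qed

section \<open>Norms of the iterates of a symmetric kernel on a vector\<close>

definition kernel_apply :: "'v set \<Rightarrow> ('v \<Rightarrow> 'v \<Rightarrow> real) \<Rightarrow> nat \<Rightarrow> ('v \<Rightarrow> real) \<Rightarrow> 'v \<Rightarrow> real" where
  "kernel_apply V a k y u = (\<Sum>v\<in>V. kernel_pow V a k u v * y v)"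

lemma kernel_apply_0:
  assumes "finite V" "u \<in> V"
  shows "kernel_apply V a 0 y u = y u"
proof -
  have "kernel_apply V a 0 y u = (\<Sum>v\<in>V. if v = u then y v else 0)"
    unfolding kernel_apply_def by (rule sum.cong) auto
  then show ?thesis using assms by simp
qed

lemma kernel_apply_Suc:
  assumes "finite V" "u \<in> V"
  shows "kernel_apply V a (Suc k) y u = (\<Sum>w\<in>V. a u w * kernel_apply V a k y w)"
proof -
  have "kernel_apply V a (Suc k) y u = (\<Sum>v\<in>V. (\<Sum>w\<in>V. a u w * kernel_pow V a k w v) * y v)"
    unfolding kernel_apply_def using kernel_pow_Suc_left[OF assms] by simp
  also have "\<dots> = (\<Sum>v\<in>V. \<Sum>w\<in>V. a u w * (kernel_pow V a k w v * y v))"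
    by (simp add: sum_distrib_right mult.assoc)
  also have "\<dots> = (\<Sum>w\<in>V. a u w * kernel_apply V a k y w)"
    unfolding kernel_apply_def by (subst sum.swap) (simp add: sum_distrib_left)
  finally show ?thesis .
qed

text \<open>Symmetry moves one factor of the matrix across the inner product: |A^(k+1) y|^2 is the
  inner product of A^k y and A^(k+2) y. Cauchy-Schwarz then gives the claim.\<close>

lemma kernel_apply_log_convex:
  assumes V: "finite V" and sym: "\<And>u v. a u v = a v u"
  shows "(\<Sum>u\<in>V. (kernel_apply V a (Suc k) y u)\<^sup>2)\<^sup>2
      \<le> (\<Sum>u\<in>V. (kernel_apply V a k y u)\<^sup>2) * (\<Sum>u\<in>V. (kernel_apply V a (Suc (Suc k)) y u)\<^sup>2)"
proof -
  let ?z = "\<lambda>k. kernel_apply V a k y"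
  have "(\<Sum>u\<in>V. (?z (Suc k) u)\<^sup>2) = (\<Sum>u\<in>V. \<Sum>w\<in>V. ?z k w * (a w u * ?z (Suc k) u))"
    using sym by (intro sum.cong refl)
      (simp add: power2_eq_square kernel_apply_Suc[OF V, of _ a k] sum_distrib_left mult_ac)
  also have "\<dots> = (\<Sum>w\<in>V. ?z k w * ?z (Suc (Suc k)) w)"
    by (subst sum.swap) (simp add: kernel_apply_Suc[OF V, of _ a "Suc k"] sum_distrib_left)
  finally show ?thesis
    using Cauchy_Schwarz_ineq_sum[of "?z k" "?z (Suc (Suc k))" V] by simp
qed

text \<open>Orthogonality of \<open>y\<close> to the constants allows one to subtract the constant part of every row
  of the matrix power before applying Cauchy--Schwarz; this is what removes the trivial
  eigenvalue.\<close>

lemma kernel_apply_bound: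
  assumes V: "finite V" "V \<noteq> {}" and sym: "\<And>u v. a u v = a v u"
    and rows: "\<And>u. u \<in> V \<Longrightarrow> (\<Sum>v\<in>V. a u v) = d" and y: "(\<Sum>v\<in>V. y v) = 0"
  shows "(\<Sum>u\<in>V. (kernel_apply V a k y u)\<^sup>2)
      \<le> ((\<Sum>u\<in>V. kernel_pow V a (2 * k) u u) - d ^ (2 * k)) * (\<Sum>v\<in>V. (y v)\<^sup>2)"
proof -
  let ?W = "kernel_pow V a k"
  define n where "n = real (card V)"
  have n: "n > 0" using V by (simp add: n_def card_gt_0_iff)
  \<comment> \<open>Every row of the \<open>k\<close>-th power sums to \<open>d ^ k\<close>, so
    \<open>t\<close> is the mean entry of a row, which minimises the sum of squared deviations used
    below.\<close>
  define t where "t = d ^ k / n"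
  have *: "(kernel_apply V a k y u)\<^sup>2 \<le> (kernel_pow V a (2 * k) u u - d ^ (2 * k) / n) * (\<Sum>v\<in>V. (y v)\<^sup>2)"
    if u: "u \<in> V" for u
  proof -
    have "kernel_apply V a k y u = (\<Sum>v\<in>V. (?W u v - t) * y v)"
      unfolding kernel_apply_def using y
      by (simp add: left_diff_distrib sum_subtractf sum_distrib_left[symmetric])
    then have "(kernel_apply V a k y u)\<^sup>2 \<le> (\<Sum>v\<in>V. (?W u v - t)\<^sup>2) * (\<Sum>v\<in>V. (y v)\<^sup>2)"
      using Cauchy_Schwarz_ineq_sum[of "\<lambda>v. ?W u v - t" y V] by simp
    also have "(\<Sum>v\<in>V. (?W u v - t)\<^sup>2) = (\<Sum>v\<in>V. (?W u v)\<^sup>2) - 2 * t * (\<Sum>v\<in>V. ?W u v) + n * t\<^sup>2"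
      by (simp add: power2_diff sum.distrib sum_subtractf sum_distrib_left n_def mult_ac)
    also have "(\<Sum>v\<in>V. ?W u v) = d ^ k"
      using kernel_pow_row_sum[OF V(1) rows u] by simp
    also have "(\<Sum>v\<in>V. (?W u v)\<^sup>2) = kernel_pow V a (2 * k) u u"
    proof -
      have "kernel_pow V a (2 * k) u u = (\<Sum>v\<in>V. ?W u v * ?W v u)"
        using kernel_pow_add[OF V(1) u u, of a k k] by (simp only: mult_2)
      also have "\<dots> = (\<Sum>v\<in>V. (?W u v)\<^sup>2)"
      proof (rule sum.cong[OF refl])
        fix v assume "v \<in> V"
        show "?W u v * ?W v u = (?W u v)\<^sup>2"
          unfolding kernel_pow_sym[OF V(1) sym \<open>v \<in> V\<close> u] by (simp only: power2_eq_square)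
      qed
      finally show ?thesis by simp
    qed
    also have "kernel_pow V a (2 * k) u u - 2 * t * d ^ k + n * t\<^sup>2 = kernel_pow V a (2 * k) u u - d ^ (2 * k) / n"
    proof -
      have "d ^ (2 * k) = (d ^ k)\<^sup>2" by (simp add: power_mult[symmetric] mult.commute)
      then show ?thesis using n by (simp add: t_def power2_eq_square field_simps)
    qed
    finally show ?thesis .
  qed
  have "(\<Sum>u\<in>V. (kernel_apply V a k y u)\<^sup>2)
      \<le> (\<Sum>u\<in>V. (kernel_pow V a (2 * k) u u - d ^ (2 * k) / n) * (\<Sum>v\<in>V. (y v)\<^sup>2))"
    by (rule sum_mono) (rule *)
  also have "\<dots> = ((\<Sum>u\<in>V. kernel_pow V a (2 * k) u u) - d ^ (2 * k)) * (\<Sum>v\<in>V. (y v)\<^sup>2)"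
    unfolding sum_distrib_right[symmetric] sum_subtractf using n by (simp add: n_def)
  finally show ?thesis .
qed

text \<open>Under log-convexity the ratios of successive values do not decrease. A first ratio
  \<open>r\<close> above \<open>q\<close> would therefore force growth like \<open>r ^ k\<close>,
  which eventually exceeds any multiple of \<open>q ^ k\<close>.\<close>

lemma log_convex_growth:
  fixes f :: "nat \<Rightarrow> real"
  assumes nonneg: "\<And>k. f k \<ge> 0" and convex: "\<And>k. (f (Suc k))\<^sup>2 \<le> f k * f (Suc (Suc k))"
    and growth: "\<And>k. f k \<le> C * q ^ k" and q: "q \<ge> 0"
  shows "f 1 \<le> q * f 0"
proof (rule ccontr)
  assume "\<not> f 1 \<le> q * f 0"
  then have f1: "f 1 > q * f 0" by simp
  have f0: "f 0 > 0"
  proof (rule ccontr)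
    assume "\<not> f 0 > 0"
    then have "f 0 = 0" using nonneg[of 0] by simp
    then show False using convex[of 0] f1 by simp
  qed
  define r where "r = f 1 / f 0"
  have r: "r > q" "r > 0" using f1 f0 q
    by (auto simp: r_def field_simps) (smt (verit) mult_nonneg_nonneg)
  have step: "f k > 0 \<and> f (Suc k) \<ge> r * f k" for k
  proof (induction k)
    case 0
    then show ?case using f0 by (simp add: r_def)
  next
    case (Suc k)
    then have pos: "f (Suc k) > 0" using r by (smt (verit) mult_pos_pos)
    have "f k * (r * f (Suc k)) \<le> f (Suc k) * f (Suc k)"
      using Suc pos mult_right_mono[of "r * f k" "f (Suc k)" "f (Suc k)"] by (simp add: mult_ac)
    also have "\<dots> \<le> f k * f (Suc (Suc k))" using convex[of k] by (simp add: power2_eq_square)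
    finally show ?case using pos Suc by simp
  qed
  have lower: "f k \<ge> r ^ k * f 0" for k
  proof (induction k)
    case (Suc k)
    have "r ^ Suc k * f 0 \<le> r * f k" using Suc r by (simp add: mult_ac)
    then show ?case using step[of k] by linarith
  qed auto
  show False
  proof (cases "q = 0")
    case True
    then show ?thesis using growth[of 1] f1 by simp
  next
    case False
    with q have q: "q > 0" by simp
    have "(r / q) ^ k * f 0 \<le> C" for k
      using lower[of k] growth[of k] q by (simp add: power_divide field_simps)
    moreover obtain k where "C / f 0 < (r / q) ^ k"
      using real_arch_pow[of "r / q"] r q by auto
    ultimately show False using f0 by (smt (verit) pos_divide_less_eq)
  qed
qed

text \<open>The trace estimate bounds |A^k y|^2 only up to the factor \<open>C\<close>. As
  \<open>C\<close> does not depend on \<open>k\<close>, \<open>log_convex_growth\<close> turns these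
  bounds for all powers into a sharp one for the first power.\<close>

lemma kernel_apply_contraction:
  assumes V: "finite V" "V \<noteq> {}" and sym: "\<And>u v. a u v = a v u"
    and rows: "\<And>u. u \<in> V \<Longrightarrow> (\<Sum>v\<in>V. a u v) = d"
    and trace: "\<And>k. (\<Sum>u\<in>V. kernel_pow V a (2 * k) u u) - d ^ (2 * k) \<le> C * l ^ (2 * k)"
    and y: "(\<Sum>v\<in>V. y v) = 0"
  shows "(\<Sum>u\<in>V. (\<Sum>v\<in>V. a u v * y v)\<^sup>2) \<le> l\<^sup>2 * (\<Sum>v\<in>V. (y v)\<^sup>2)"
proof -
  define f where "f k = (\<Sum>u\<in>V. (kernel_apply V a k y u)\<^sup>2)" for k
  have "f 1 \<le> l\<^sup>2 * f 0"
  proof (rule log_convex_growth)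
    show "f k \<ge> 0" for k by (simp add: f_def sum_nonneg)
    show "(f (Suc k))\<^sup>2 \<le> f k * f (Suc (Suc k))" for k
      unfolding f_def by (rule kernel_apply_log_convex[OF V(1) sym])
    show "f k \<le> (C * (\<Sum>v\<in>V. (y v)\<^sup>2)) * (l\<^sup>2) ^ k" for k
    proof -
      have "f k \<le> ((\<Sum>u\<in>V. kernel_pow V a (2 * k) u u) - d ^ (2 * k)) * (\<Sum>v\<in>V. (y v)\<^sup>2)"
        unfolding f_def by (rule kernel_apply_bound[OF V sym rows y])
      also have "\<dots> \<le> C * l ^ (2 * k) * (\<Sum>v\<in>V. (y v)\<^sup>2)"
        by (rule mult_right_mono[OF trace]) (simp add: sum_nonneg)
      finally show ?thesis unfolding power_mult[of l 2 k] by (simp only: mult_ac)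
    qed
  qed simp
  moreover have "f 1 = (\<Sum>u\<in>V. (\<Sum>v\<in>V. a u v * y v)\<^sup>2)"
    unfolding f_def kernel_apply_def using kernel_pow_one[OF V(1)] by (auto intro!: sum.cong)
  moreover have "f 0 = (\<Sum>v\<in>V. (y v)\<^sup>2)"
    unfolding f_def using kernel_apply_0[OF V(1)] by (auto intro!: sum.cong)
  ultimately show ?thesis by simp
qed

text \<open>The vector \<open>y\<close> is the indicator of \<open>B\<close> made orthogonal to the
  constants. In the rows of \<open>A\<close> the indicator contributes nothing, so A y is constantly
  \<open>- (d * \<beta> / n)\<close> there. Comparing this part of |A y|^2 with the contraction
  bound gives the claim. \<open>A\<close> and \<open>B\<close> may overlap.\<close>

lemma mixing_bound:
  assumes V: "finite V" and sym: "\<And>u v. a u v = a v u"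
    and rows: "\<And>u. u \<in> V \<Longrightarrow> (\<Sum>v\<in>V. a u v) = d"
    and trace: "\<And>k. (\<Sum>u\<in>V. kernel_pow V a (2 * k) u u) - d ^ (2 * k) \<le> C * l ^ (2 * k)"
    and AB: "A \<subseteq> V" "B \<subseteq> V" and zero: "\<And>u v. u \<in> A \<Longrightarrow> v \<in> B \<Longrightarrow> a u v = 0" and d: "d > 0"
  shows "real (card A) * real (card B) \<le> (l * real (card V) / d)\<^sup>2"
proof (cases "A = {} \<or> B = {}")
  case False
  then have V': "V \<noteq> {}" using AB by auto
  have fin: "finite A" "finite B" using AB V finite_subset by auto
  define n where "n = real (card V)"
  have n: "n > 0" using V V' by (simp add: n_def card_gt_0_iff)
  define \<alpha> where "\<alpha> = real (card A)"
  define \<beta> where "\<beta> = real (card B)"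
  have pos: "\<alpha> > 0" "\<beta> > 0" using fin False by (auto simp: \<alpha>_def \<beta>_def card_gt_0_iff)
  define y where "y v = of_bool (v \<in> B) - \<beta> / n" for v
  have ind: "(\<Sum>v\<in>V. of_bool (v \<in> B)) = \<beta>"
    using AB(2) V by (simp add: \<beta>_def sum.If_cases of_bool_def Int_absorb1)
  have y0: "(\<Sum>v\<in>V. y v) = 0"
    using ind n by (simp add: y_def sum_subtractf n_def)
  have "(y v)\<^sup>2 = (1 - 2 * \<beta> / n) * of_bool (v \<in> B) + (\<beta> / n)\<^sup>2" for v
    by (auto simp: y_def power2_eq_square algebra_simps)
  then have "(\<Sum>v\<in>V. (y v)\<^sup>2) = (1 - 2 * \<beta> / n) * \<beta> + n * (\<beta> / n)\<^sup>2"
    using ind by (simp add: sum.distrib sum_distrib_left[symmetric] n_def)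
  also have "\<dots> = \<beta> - \<beta>\<^sup>2 / n" using n by (simp add: power2_eq_square field_simps)
  also have "\<dots> \<le> \<beta>" using n by simp
  finally have y2: "(\<Sum>v\<in>V. (y v)\<^sup>2) \<le> \<beta>" .
  have row: "(\<Sum>v\<in>V. a u v * y v) = - (d * \<beta> / n)" if u: "u \<in> A" for u
  proof -
    have "(\<Sum>v\<in>V. a u v * y v) = (\<Sum>v\<in>V. - (\<beta> / n) * a u v)"
      using zero u by (intro sum.cong refl) (auto simp: y_def)
    also have "\<dots> = - (\<beta> / n) * (\<Sum>v\<in>V. a u v)"
      by (rule sum_distrib_left[symmetric])
    also have "(\<Sum>v\<in>V. a u v) = d" using rows u AB by blast
    finally show ?thesis by (simp add: mult_ac)
  qed
  have "\<alpha> * (d * \<beta> / n)\<^sup>2 = (\<Sum>u\<in>A. (\<Sum>v\<in>V. a u v * y v)\<^sup>2)"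
    using row by (simp add: \<alpha>_def)
  also have "\<dots> \<le> (\<Sum>u\<in>V. (\<Sum>v\<in>V. a u v * y v)\<^sup>2)"
    using V AB by (intro sum_mono2) auto
  also have "\<dots> \<le> l\<^sup>2 * (\<Sum>v\<in>V. (y v)\<^sup>2)"
    by (rule kernel_apply_contraction[OF V V' sym rows trace y0])
  also have "\<dots> \<le> l\<^sup>2 * \<beta>" using y2 by (simp add: mult_left_mono)
  finally have "\<alpha> * \<beta> * d\<^sup>2 \<le> l\<^sup>2 * n\<^sup>2"
    using pos n by (simp add: power2_eq_square field_simps)
  then have "\<alpha> * \<beta> \<le> (l * n / d)\<^sup>2"
    using d by (simp add: power_divide power_mult_distrib field_simps)
  then show ?thesis by (simp add: \<alpha>_def \<beta>_def n_def)
qed auto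

section \<open>From the spectrum of the adjacency matrix to mixing\<close>

lemma adjacency_matrix_pow:
  assumes vs: "distinct vs" "set vs = V" and ij: "i < length vs" "j < length vs"
  shows "(adjacency_matrix vs E ^\<^sub>m k) $$ (i, j)
      = of_real (kernel_pow V (\<lambda>u v. of_bool ({u, v} \<in> E)) k (vs ! i) (vs ! j))"
  using ij
proof (induction k arbitrary: j)
  case 0
  then show ?case using vs by (auto simp: adjacency_matrix_def nth_eq_iff_index_eq)
next
  case (Suc k)
  let ?A = "adjacency_matrix vs E" and ?a = "\<lambda>u v. of_bool ({u, v} \<in> E)"
  have A: "?A \<in> carrier_mat (length vs) (length vs)" by (simp add: adjacency_matrix_def)
  have "(?A ^\<^sub>m Suc k) $$ (i, j) = (\<Sum>l<length vs. (?A ^\<^sub>m k) $$ (i, l) * ?A $$ (l, j))"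
    using A Suc.prems by (auto simp: scalar_prod_def atLeast0LessThan intro!: sum.cong)
  also have "\<dots> = of_real (\<Sum>l<length vs. kernel_pow V ?a k (vs ! i) (vs ! l) * ?a (vs ! l) (vs ! j))"
  proof -
    have "?A $$ (l, j) = of_real (?a (vs ! l) (vs ! j))" if "l < length vs" for l
      using that Suc.prems by (simp add: adjacency_matrix_def)
    then show ?thesis
      unfolding of_real_sum of_real_mult
      by (intro sum.cong refl) (simp only: lessThan_iff Suc.IH[OF Suc.prems(1)])
  qed
  also have "(\<Sum>l<length vs. kernel_pow V ?a k (vs ! i) (vs ! l) * ?a (vs ! l) (vs ! j))
      = (\<Sum>w\<in>V. kernel_pow V ?a k (vs ! i) w * ?a w (vs ! j))"
    using bij_betw_nth[OF vs(1) refl vs(2)[symmetric]]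
    by (rule sum.reindex_bij_betw[where h = "(!) vs"])
  finally show ?case by simp
qed

lemma sum_mset_power_minus_le:
  fixes M :: "complex multiset"
  assumes "\<And>\<mu>. \<mu> \<in># M - {#z#} \<Longrightarrow> cmod \<mu> \<le> l" and "l \<ge> 0" and "z \<in> \<real>"
  shows "Re (\<Sum>\<mu>\<in>#M. \<mu> ^ (2 * k)) - Re z ^ (2 * k) \<le> real (size M) * l ^ (2 * k)"
proof -
  let ?N = "M - {#z#}"
  have *: "Re (\<Sum>\<mu>\<in>#N. \<mu> ^ (2 * k)) \<le> real (size N) * l ^ (2 * k)"
    if "\<And>\<mu>. \<mu> \<in># N \<Longrightarrow> cmod \<mu> \<le> l" for N :: "complex multiset"
    using that
  proof (induction N)
    case (add x N)
    have "Re (x ^ (2 * k)) \<le> cmod x ^ (2 * k)"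
      using complex_Re_le_cmod[of "x ^ (2 * k)"] by (simp add: norm_power)
    also have "\<dots> \<le> l ^ (2 * k)" using add.prems[of x] by (intro power_mono) auto
    finally show ?case using add by (auto simp: algebra_simps intro: add_mono)
  qed auto
  have "Re (\<Sum>\<mu>\<in>#?N. \<mu> ^ (2 * k)) \<le> real (size ?N) * l ^ (2 * k)"
    using assms(1) by (rule *)
  also have "\<dots> \<le> real (size M) * l ^ (2 * k)"
    using assms(2) by (intro mult_right_mono) (auto simp: size_mset_mono)
  finally have N: "Re (\<Sum>\<mu>\<in>#?N. \<mu> ^ (2 * k)) \<le> real (size M) * l ^ (2 * k)" .
  show ?thesis
  proof (cases "z \<in># M")
    case True
    then have "M = add_mset z ?N" by simp
    then have "(\<Sum>\<mu>\<in>#M. \<mu> ^ (2 * k)) = z ^ (2 * k) + (\<Sum>\<mu>\<in>#?N. \<mu> ^ (2 * k))"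
      by (metis image_mset_add_mset sum_mset.add_mset)
    moreover have "Re (z ^ (2 * k)) = Re z ^ (2 * k)"
      using assms(3) by (auto elim!: Reals_cases simp flip: of_real_power)
    ultimately show ?thesis using N by simp
  next
    \<comment> \<open>Nothing is removed here, and the subtracted power of \<open>Re z\<close> is
      nonnegative because its exponent is even.\<close>
    case False
    then have "?N = M" by (simp add: diff_single_trivial)
    then show ?thesis using N by (simp add: power_mult) (smt (verit) zero_le_power2 zero_le_power)
  qed
qed

text \<open>For the 0/1 kernel of adjacency the trace hypothesis of \<open>mixing_bound\<close>
  holds with \<open>C = n\<close>: apart from one copy of \<open>d\<close>, each of the
  \<open>n\<close> roots of the characteristic polynomial adds at most
  \<open>l ^ (2 * k)\<close>.\<close>

lemma ndl_graph_mixing: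
  assumes G: "ndl_graph V E n d l" and d: "d > 0" and l: "l \<ge> 0"
    and AB: "A \<subseteq> V" "B \<subseteq> V" and no_edge: "\<And>u v. u \<in> A \<Longrightarrow> v \<in> B \<Longrightarrow> {u, v} \<notin> E"
  shows "real (card A) * real (card B) \<le> (l * real n / real d)\<^sup>2"
proof -
  let ?a = "\<lambda>u v. of_bool ({u, v} \<in> E) :: real"
  obtain vs where vs: "distinct vs" "set vs = V"
    and ev: "\<And>\<mu>. \<mu> \<in># proots (char_poly (adjacency_matrix vs E)) - {#of_nat d#} \<Longrightarrow> cmod \<mu> \<le> l"
    using G unfolding ndl_graph_def by blast
  have V: "finite V" and E: "\<And>e. e \<in> E \<Longrightarrow> e \<subseteq> V \<and> card e = 2" and n: "card V = n"
    and deg: "\<And>v. v \<in> V \<Longrightarrow> card {e\<in>E. v \<in> e} = d"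
    using G unfolding ndl_graph_def regular_graph_def simple_graph_def by auto
  have rows: "(\<Sum>v\<in>V. ?a u v) = real d" if u: "u \<in> V" for u
  proof -
    have inj: "inj_on (\<lambda>v. {u, v}) {v\<in>V. {u, v} \<in> E}"
      by (auto simp: inj_on_def doubleton_eq_iff)
    have "{e\<in>E. u \<in> e} = (\<lambda>v. {u, v}) ` {v\<in>V. {u, v} \<in> E}"
    proof (intro equalityI subsetI)
      fix e assume e: "e \<in> {e\<in>E. u \<in> e}"
      then obtain x y where xy: "e = {x, y}" using E card_2_iff by (metis mem_Collect_eq)
      then have "e = {u, x} \<or> e = {u, y}" using e by auto
      then show "e \<in> (\<lambda>v. {u, v}) ` {v\<in>V. {u, v} \<in> E}" using e E by auto
    qed auto
    then have "card {v\<in>V. {u, v} \<in> E} = d" using card_image[OF inj] deg[OF u] by simp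
    then show ?thesis using V by (simp add: of_bool_def sum.If_cases Int_def)
  qed
  have len: "length vs = n" using distinct_card[OF vs(1)] vs(2) n by simp
  have A: "adjacency_matrix vs E \<in> carrier_mat n n"
    using len by (simp add: adjacency_matrix_def)
  have trace: "(\<Sum>u\<in>V. kernel_pow V ?a (2 * k) u u) - real d ^ (2 * k) \<le> real n * l ^ (2 * k)" for k
  proof -
    have "(\<Sum>u\<in>V. kernel_pow V ?a (2 * k) u u) = (\<Sum>i<n. kernel_pow V ?a (2 * k) (vs ! i) (vs ! i))"
      using bij_betw_nth[OF vs(1) refl vs(2)[symmetric]]
      unfolding len by (rule sum.reindex_bij_betw[symmetric, where h = "(!) vs"])
    also have "\<dots> = Re (\<Sum>i<n. (adjacency_matrix vs E ^\<^sub>m (2 * k)) $$ (i, i))"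
      using adjacency_matrix_pow[OF vs] len by simp
    also have "\<dots> = Re (\<Sum>\<mu>\<in>#proots (char_poly (adjacency_matrix vs E)). \<mu> ^ (2 * k))"
      by (simp only: sum_diag_pow_eq_sum_proots(1)[OF A])
    finally show ?thesis
      using sum_mset_power_minus_le[of "proots (char_poly (adjacency_matrix vs E))" "of_nat d" l k, OF ev l]
       sum_diag_pow_eq_sum_proots(2)[OF A] by simp
  qed
  have "real (card A) * real (card B) \<le> (l * real (card V) / real d)\<^sup>2"
    by (rule mixing_bound[OF V _ rows trace AB]) (use no_edge d in \<open>auto simp: insert_commute\<close>)
  then show ?thesis by (simp add: n)
qed

subsection \<open>Hall's theorem\<close>

text \<open>Induction in the style of Halmos and Vaughan. If a proper nonempty \<open>S\<close> has
  no surplus of neighbours, \<open>S\<close> is matched first and the rest is matched outside the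
  neighbourhood of \<open>S\<close>. If every such set has a surplus, an arbitrary pair can be
  matched and removed.\<close>

lemma hall_marriage:
  fixes N :: "'a \<Rightarrow> 'b set"
  assumes "finite X" and "\<And>x. x \<in> X \<Longrightarrow> finite (N x)"
    and "\<And>S. S \<subseteq> X \<Longrightarrow> card S \<le> card (\<Union>x\<in>S. N x)"
  shows "\<exists>h. inj_on h X \<and> (\<forall>x\<in>X. h x \<in> N x)"
  using assms
proof (induction "card X" arbitrary: X N rule: less_induct)
  case less
  note fin = less.prems(1) and finN = less.prems(2) and hall = less.prems(3)
  show ?case
  proof (cases "X = {}")
    case False
    show ?thesis
    proof (cases "\<exists>S. S \<subset> X \<and> S \<noteq> {} \<and> card (\<Union>x\<in>S. N x) \<le> card S")
      case True
      then obtain S where S: "S \<subset> X" "S \<noteq> {}" "card (\<Union>x\<in>S. N x) \<le> card S" by blast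
      let ?NS = "\<Union>x\<in>S. N x"
      have finS: "finite S" using S fin finite_subset by blast
      have finNS: "finite ?NS" using finS finN S by auto
      have "\<exists>h. inj_on h S \<and> (\<forall>x\<in>S. h x \<in> N x)"
        using S finN hall by (intro less.hyps psubset_card_mono[OF fin] finS) (blast intro: finN)+
      then obtain h1 where h1: "inj_on h1 S" "\<forall>x\<in>S. h1 x \<in> N x" by blast
      have "\<exists>h. inj_on h (X - S) \<and> (\<forall>x\<in>X - S. h x \<in> N x - ?NS)"
      proof (rule less.hyps)
        show "card (X - S) < card X" using S fin by (intro psubset_card_mono) auto
        show "finite (X - S)" using fin by simp
        show "finite (N x - ?NS)" if "x \<in> X - S" for x using finN that by simp
        fix T assume T: "T \<subseteq> X - S"
        let ?M = "\<Union>x\<in>T. N x - ?NS"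
        have finT: "finite T" using T fin finite_subset by blast
        have finM: "finite ?M" using finT T finN by auto
        \<comment> \<open>Hall's condition for the union of \<open>S\<close> and \<open>T\<close>,
          less the at most \<open>card S\<close> neighbours of \<open>S\<close>, leaves
          \<open>card T\<close> neighbours outside \<open>?NS\<close>.\<close>
        have "card S + card T = card (S \<union> T)"
          using T finS finT by (intro card_Un_disjoint[symmetric]) auto
        also have "\<dots> \<le> card (\<Union>x\<in>S \<union> T. N x)" using T S by (intro hall) auto
        also have "(\<Union>x\<in>S \<union> T. N x) = ?NS \<union> ?M" by auto
        also have "card (?NS \<union> ?M) = card ?NS + card ?M"
          using finNS finM by (intro card_Un_disjoint) auto
        finally show "card T \<le> card ?M" using S(3) by linarith
      qed
      then obtain h2 where h2: "inj_on h2 (X - S)" "\<forall>x\<in>X - S. h2 x \<in> N x - ?NS" by blast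
      define h where "h x = (if x \<in> S then h1 x else h2 x)" for x
      have "inj_on h (S \<union> (X - S))"
      proof (rule inj_on_Un[THEN iffD2], intro conjI)
        show "inj_on h S" using h1 by (simp add: h_def inj_on_def)
        show "inj_on h (X - S)" using h2 by (simp add: h_def inj_on_def)
        show "h ` (S - (X - S)) \<inter> h ` (X - S - S) = {}"
          using h1 h2 by (auto simp: h_def) 
      qed
      moreover have "S \<union> (X - S) = X" using S by auto
      moreover have "\<forall>x\<in>X. h x \<in> N x" using h1 h2 by (auto simp: h_def)
      ultimately show ?thesis by auto
    next
      case nontight: False
      obtain x where x: "x \<in> X" using False by blast
      have "card {x} \<le> card (\<Union>z\<in>{x}. N z)" by (rule hall) (use x in auto)
      then obtain y where y: "y \<in> N x" by fastforce
      have "\<exists>h. inj_on h (X - {x}) \<and> (\<forall>z\<in>X - {x}. h z \<in> N z - {y})"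
      proof (rule less.hyps)
        show "card (X - {x}) < card X" using x fin by (intro psubset_card_mono) auto
        show "finite (X - {x})" using fin by simp
        show "finite (N z - {y})" if "z \<in> X - {x}" for z using finN that by simp
        fix T assume T: "T \<subseteq> X - {x}"
        show "card T \<le> card (\<Union>z\<in>T. N z - {y})"
        proof (cases "T = {}")
          case nonempty: False
          have "T \<subset> X" using T x by blast
          \<comment> \<open>The strict inequality pays for the loss of \<open>y\<close>.\<close>
          then have "card T < card (\<Union>z\<in>T. N z)"
            using nontight nonempty by (meson not_le)
          moreover have "(\<Union>z\<in>T. N z - {y}) = (\<Union>z\<in>T. N z) - {y}" by auto
          ultimately show ?thesis
            by (auto simp: card_Diff_singleton_if)
        qed simp
      qed
      then obtain h where h: "inj_on h (X - {x})" "\<forall>z\<in>X - {x}. h z \<in> N z - {y}" by blast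
      have "inj_on (h(x := y)) X"
        using h by (auto simp: inj_on_def)
      then show ?thesis using h y by (intro exI[of _ "h(x := y)"]) auto
    qed
  qed auto
qed

text \<open>Giving every element the same \<open>\<delta>\<close> dummy neighbours restores Hall's
  condition. At most \<open>\<delta>\<close> elements are then matched to dummies, and discarding
  them leaves a genuine matching.\<close>

lemma hall_deficiency:
  fixes N :: "'a \<Rightarrow> 'b set"
  assumes X: "finite X" and finN: "\<And>x. x \<in> X \<Longrightarrow> finite (N x)"
    and hall: "\<And>S. S \<subseteq> X \<Longrightarrow> card S \<le> card (\<Union>x\<in>S. N x) + \<delta>"
  shows "\<exists>Y h. Y \<subseteq> X \<and> card X \<le> card Y + \<delta> \<and> inj_on h Y \<and> (\<forall>x\<in>Y. h x \<in> N x)"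
proof -
  define M :: "'a \<Rightarrow> ('b + nat) set" where "M x = Inl ` N x \<union> Inr ` {..<\<delta>}" for x
  have "\<exists>g. inj_on g X \<and> (\<forall>x\<in>X. g x \<in> M x)"
  proof (rule hall_marriage[OF X])
    show "finite (M x)" if "x \<in> X" for x using finN[OF that] by (simp add: M_def)
    fix S assume S: "S \<subseteq> X"
    show "card S \<le> card (\<Union>x\<in>S. M x)"
    proof (cases "S = {}")
      case False
      have fin: "finite (\<Union>x\<in>S. N x)" using S X finN by (meson finite_UN_I rev_finite_subset subsetD)
      have "(\<Union>x\<in>S. M x) = Inl ` (\<Union>x\<in>S. N x) \<union> Inr ` {..<\<delta>}"
        using False by (auto simp: M_def)
      also have "card \<dots> = card (\<Union>x\<in>S. N x) + \<delta>"
        using fin by (subst card_Un_disjoint) (auto simp: card_image)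
      finally show ?thesis using hall[OF S] by simp
    qed simp
  qed
  then obtain g where g: "inj_on g X" "\<And>x. x \<in> X \<Longrightarrow> g x \<in> M x" by blast
  define Y where "Y = {x\<in>X. g x \<in> range Inl}"
  have "g ` (X - Y) \<subseteq> Inr ` {..<\<delta>}" using g(2) by (fastforce simp: Y_def M_def)
  then have "card (g ` (X - Y)) \<le> card (Inr ` {..<\<delta>} :: ('b + nat) set)"
    by (intro card_mono) auto
  moreover have "card (g ` (X - Y)) = card X - card Y"
    using g(1) X by (subst card_image) (auto simp: Y_def inj_on_def intro!: card_Diff_subset)
  ultimately have "card X \<le> card Y + \<delta>" by (simp add: card_image)
  moreover have "inj_on (projl \<circ> g) Y"
    using g(1) by (auto simp: inj_on_def Y_def)
  moreover have "\<forall>x\<in>Y. (projl \<circ> g) x \<in> N x"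
    using g(2) by (fastforce simp: Y_def M_def)
  ultimately show ?thesis by (intro exI[of _ Y] exI[of _ "projl \<circ> g"]) (auto simp: Y_def)
qed

subsection \<open>Trees\<close>

text \<open>This presentation of trees supplies the induction for embeddings: each new vertex hangs
  by a single edge on a vertex already placed.\<close>

inductive leaf_built :: "'t set \<Rightarrow> 't set set \<Rightarrow> bool" where
  single: "leaf_built {v} {}"
| leaf: "leaf_built S F \<Longrightarrow> u \<in> S \<Longrightarrow> v \<notin> S \<Longrightarrow> leaf_built (insert v S) (insert {u, v} F)"

lemma leaf_built_finite: "leaf_built S F \<Longrightarrow> finite S \<and> S \<noteq> {} \<and> (\<forall>e\<in>F. e \<subseteq> S)"
  by (induction rule: leaf_built.induct) auto

text \<open>The path stays inside the partial tree, so a vertex outside with two neighbours in the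
  tree would close it to a cycle.\<close>

lemma leaf_built_path:
  assumes "leaf_built S F" "u \<in> S" "w \<in> S"
  shows "\<exists>p. p \<noteq> [] \<and> hd p = u \<and> last p = w \<and> distinct p \<and> set p \<subseteq> S \<and>
    successively (\<lambda>x y. {x, y} \<in> F) p"
  using assms
proof (induction arbitrary: u w rule: leaf_built.induct)
  case (single v)
  then show ?case by (intro exI[of _ "[v]"]) auto
next
  case (leaf S F x v)
  have mono: "successively (\<lambda>x y. {x, y} \<in> insert e F) p"
    if "successively (\<lambda>x y. {x, y} \<in> F) p" for p e
    using that by (rule successively_mono) auto
  consider "u \<in> S" "w \<in> S" | "u = v" "w = v" | "u = v" "w \<in> S" | "u \<in> S" "w = v"
    using leaf.prems by auto
  then show ?case
  proof cases
    case 1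
    then obtain p where "p \<noteq> []" "hd p = u" "last p = w" "distinct p" "set p \<subseteq> S"
        "successively (\<lambda>x y. {x, y} \<in> F) p"
      using leaf.IH by blast
    then show ?thesis using mono by (intro exI[of _ p]) auto
  next
    case 2
    then show ?thesis by (intro exI[of _ "[v]"]) auto
  next
    case 3
    then obtain p where "p \<noteq> []" "hd p = x" "last p = w" "distinct p" "set p \<subseteq> S"
        "successively (\<lambda>x y. {x, y} \<in> F) p"
      using leaf.IH leaf.hyps by blast
    then show ?thesis using mono 3 leaf.hyps
      by (intro exI[of _ "v # p"]) (auto simp: successively_Cons insert_commute)
  next
    case 4
    then obtain p where "p \<noteq> []" "hd p = u" "last p = x" "distinct p" "set p \<subseteq> S"
        "successively (\<lambda>x y. {x, y} \<in> F) p"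
      using leaf.IH leaf.hyps by blast
    then show ?thesis using mono 4 leaf.hyps
      by (intro exI[of _ "p @ [v]"]) (auto simp: successively_append_iff)
  qed
qed

lemma is_cycle_path_closed:
  assumes p: "p \<noteq> []" "hd p \<noteq> last p" "distinct p" "successively (\<lambda>x y. {x, y} \<in> E) p"
    and v: "v \<notin> set p" "{last p, v} \<in> E" "{v, hd p} \<in> E"
  shows "is_cycle E (p @ [v])"
proof -
  have len: "length p \<ge> 2" using p(1,2) by (cases p) (auto simp: Suc_le_eq)
  have "{(p @ [v]) ! i, (p @ [v]) ! (Suc i mod length (p @ [v]))} \<in> E" if i: "i < length (p @ [v])" for i
  proof -
    \<comment> \<open>These are the edges of the path, the edge from its end to \<open>v\<close>,
      and the closing edge, for which the successor index wraps to 0.\<close>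
    consider "Suc i < length p" | "Suc i = length p" | "i = length p"
      using i by fastforce
    then show ?thesis
    proof cases
      case 1
      then show ?thesis using p(4) by (simp add: nth_append successively_conv_nth)
    next
      case 2
      then have "length p - 1 = i" by simp
      then have "(p @ [v]) ! i = last p" using p(1) 2 by (simp add: nth_append last_conv_nth)
      then show ?thesis using v(2) 2 by simp
    next
      case 3
      then show ?thesis using v(3) p(1) by (simp add: nth_append hd_conv_nth)
    qed
  qed
  then show ?thesis unfolding is_cycle_def using len p v by auto
qed

text \<open>A maximal vertex set whose induced subgraph is leaf-built must be all of
  \<open>V\<close>. Otherwise connectivity supplies an edge leaving it, and acyclicity makes that
  edge the only one from its outer end into the set, so the set could be enlarged.\<close>

lemma tree_graph_leaf_built:
  assumes T: "tree_graph V E"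
  shows "leaf_built V E"
proof -
  have V: "finite V" "V \<noteq> {}" and E: "\<And>e. e \<in> E \<Longrightarrow> e \<subseteq> V \<and> card e = 2"
    and conn: "\<And>u v. u \<in> V \<Longrightarrow> v \<in> V \<Longrightarrow> (u, v) \<in> {(x, y). {x, y} \<in> E}\<^sup>*"
    and acyclic: "\<And>p. \<not> is_cycle E p"
    using T unfolding tree_graph_def simple_graph_def connected_graph_def by auto
  define \<S> where "\<S> = {S. S \<subseteq> V \<and> leaf_built S {e\<in>E. e \<subseteq> S}}"
  obtain v0 where v0: "v0 \<in> V" using V by blast
  have "{e\<in>E. e \<subseteq> {v0}} = {}" using E by (fastforce simp: subset_singleton_iff)
  then have "leaf_built {v0} {e\<in>E. e \<subseteq> {v0}}" by (simp only: leaf_built.single)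
  then have "{v0} \<in> \<S>" using v0 by (simp add: \<S>_def)
  moreover have "finite \<S>" using V by (simp add: \<S>_def)
  ultimately obtain S where S: "S \<in> \<S>" and max: "\<And>S'. S' \<in> \<S> \<Longrightarrow> S \<subseteq> S' \<Longrightarrow> S = S'"
    using finite_has_maximal[of \<S>] by blast
  have SV: "S \<subseteq> V" and built: "leaf_built S {e\<in>E. e \<subseteq> S}" using S by (auto simp: \<S>_def)
  have "S = V"
  proof (rule ccontr)
    assume "S \<noteq> V"
    then obtain t where t: "t \<in> V" "t \<notin> S" using SV by blast
    obtain s where s: "s \<in> S" using leaf_built_finite[OF built] by blast
    have "(s, t) \<in> {(x, y). {x, y} \<in> E}\<^sup>*" using conn s SV t by blast
    \<comment> \<open>Invariant along a walk from \<open>s\<close>: the vertex reached is in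
      \<open>S\<close>, or some edge leaves \<open>S\<close>.\<close>
    then have "t \<in> S \<or> (\<exists>x y. x \<in> S \<and> y \<notin> S \<and> {x, y} \<in> E)"
      by (induction rule: rtrancl_induct) (use s in auto)
    then obtain x y where xy: "x \<in> S" "y \<notin> S" "{x, y} \<in> E" using t by blast
    have "{e\<in>E. e \<subseteq> insert y S} = insert {x, y} {e\<in>E. e \<subseteq> S}"
    proof (intro equalityI subsetI)
      fix e assume e: "e \<in> {e\<in>E. e \<subseteq> insert y S}"
      show "e \<in> insert {x, y} {e\<in>E. e \<subseteq> S}"
      proof (cases "y \<in> e")
        case True
        obtain z where z: "e = {z, y}" "z \<noteq> y"
          using E e True by (metis (no_types, lifting) card_2_iff insertE insert_commute mem_Collect_eq singletonD)
        then have zS: "z \<in> S" using e by auto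
        have "z = x"
        proof (rule ccontr)
          assume "z \<noteq> x"
          obtain p where p: "p \<noteq> []" "hd p = x" "last p = z" "distinct p" "set p \<subseteq> S"
              "successively (\<lambda>a b. {a, b} \<in> {e\<in>E. e \<subseteq> S}) p"
            using leaf_built_path[OF built xy(1) zS] by blast
          have "successively (\<lambda>a b. {a, b} \<in> E) p"
            using p(6) by (rule successively_mono) auto
          then have "is_cycle E (p @ [y])"
            using p \<open>z \<noteq> x\<close> xy z e by (intro is_cycle_path_closed) (auto simp: insert_commute)
          then show False using acyclic by blast
        qed
        then show ?thesis using z by simp
      qed (use e in auto)
    qed (use xy in auto)
    then have "insert y S \<in> \<S>"
      using leaf_built.leaf[OF built xy(1,2)] E[OF xy(3)] SV by (simp add: \<S>_def)
    then show False using max[of "insert y S"] xy by blast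
  qed
  moreover have "{e\<in>E. e \<subseteq> V} = E" using E by auto
  ultimately show ?thesis using built by simp
qed

subsection \<open>Disjoint copies of a tree\<close>

text \<open>Edges are preserved but not reflected, as copies need not be induced. The edge set of
  the copy is fixed later as the image of the tree edges, and reflection then follows from
  injectivity.\<close>

definition colored_embedding ::
    "'v set set \<Rightarrow> ('v set \<Rightarrow> 'c) \<Rightarrow> 't set \<Rightarrow> 't set set \<Rightarrow> ('t set \<Rightarrow> 'c) \<Rightarrow> 'v set
      \<Rightarrow> ('t \<Rightarrow> 'v) \<Rightarrow> bool" where
  "colored_embedding E c S F cT U f \<longleftrightarrow> inj_on f S \<and> f ` S \<subseteq> U \<and>
     (\<forall>x\<in>S. \<forall>y\<in>S. {x, y} \<in> F \<longrightarrow> {f x, f y} \<in> E \<and> c {f x, f y} = cT {x, y})"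

text \<open>Indexing the copies by numbers makes dropping some of them and extending the others a
  matter of renumbering.\<close>

definition packs ::
    "'v set set \<Rightarrow> ('v set \<Rightarrow> 'c) \<Rightarrow> 't set \<Rightarrow> 't set set \<Rightarrow> ('t set \<Rightarrow> 'c) \<Rightarrow> 'v set \<Rightarrow> nat \<Rightarrow> bool" where
  "packs E c S F cT U p \<longleftrightarrow> (\<exists>G. (\<forall>i<p. colored_embedding E c S F cT U (G i)) \<and>
     (\<forall>i<p. \<forall>j<p. i \<noteq> j \<longrightarrow> G i ` S \<inter> G j ` S = {}))"

lemma packsI:
  assumes "\<And>i. i < p \<Longrightarrow> colored_embedding E c S F cT U (G i)"
    and "\<And>i j. i < p \<Longrightarrow> j < p \<Longrightarrow> i \<noteq> j \<Longrightarrow> G i ` S \<inter> G j ` S = {}"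
  shows "packs E c S F cT U p"
  unfolding packs_def by (rule exI[of _ G]) (simp add: assms)

lemma packsE:
  assumes "packs E c S F cT U p"
  obtains G where "\<forall>i<p. colored_embedding E c S F cT U (G i)"
    and "\<forall>i<p. \<forall>j<p. i \<noteq> j \<longrightarrow> G i ` S \<inter> G j ` S = {}"
  using assms unfolding packs_def by (elim exE conjE) (rule that)

lemma packs_disjoint_copies:
  assumes packs: "packs E c VT ET cT U p" and VT: "VT \<noteq> {}" and ET: "\<And>e. e \<in> ET \<Longrightarrow> e \<subseteq> VT \<and> card e = 2"
  shows "\<exists>\<C>. finite \<C> \<and> disjoint_copies E c VT ET cT U \<C> \<and> card \<C> = p"
proof -
  obtain G where G: "\<forall>i<p. colored_embedding E c VT ET cT U (G i)"
      "\<forall>i<p. \<forall>j<p. i \<noteq> j \<longrightarrow> G i ` VT \<inter> G j ` VT = {}"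
    using packs by (rule packsE)
  note emb = G(1)[rule_format] and disj = G(2)[rule_format]
  define H where "H i = (G i ` VT, (\<lambda>e. G i ` e) ` ET)" for i
  have copy: "copy_in E c VT ET cT U (H i)" if i: "i < p" for i
  proof -
    have inj: "inj_on (G i) VT" and sub: "G i ` VT \<subseteq> U"
      and edge: "\<And>x y. x \<in> VT \<Longrightarrow> y \<in> VT \<Longrightarrow> {x, y} \<in> ET \<Longrightarrow> {G i x, G i y} \<in> E \<and> c {G i x, G i y} = cT {x, y}"
      using emb[OF i] unfolding colored_embedding_def by blast+
    have "G i ` e \<in> E" if e: "e \<in> ET" for e
    proof -
      obtain x y where "e = {x, y}" using ET[OF e] card_2_iff by metis
      then have "x \<in> VT" "y \<in> VT" "{x, y} \<in> ET" using ET[OF e] e by blast+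
      then have "{G i x, G i y} \<in> E" using edge by blast
      then show ?thesis using \<open>e = {x, y}\<close> by simp
    qed
    moreover have "{x, y} \<in> ET \<longleftrightarrow> {G i x, G i y} \<in> (\<lambda>e. G i ` e) ` ET" if xy: "x \<in> VT" "y \<in> VT" for x y
    proof
      assume "{x, y} \<in> ET"
      then have "G i ` {x, y} \<in> (\<lambda>e. G i ` e) ` ET" by (rule imageI)
      then show "{G i x, G i y} \<in> (\<lambda>e. G i ` e) ` ET" by simp
    next
      assume "{G i x, G i y} \<in> (\<lambda>e. G i ` e) ` ET"
      then obtain e where e: "e \<in> ET" "{G i x, G i y} = G i ` e" by (rule imageE)
      then have "G i ` {x, y} = G i ` e" by simp
      then have "{x, y} = e"
        by (rule inj_on_image_eq_iff[OF inj, THEN iffD1, rotated 2]) (use xy ET[OF e(1)] in simp_all)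
      then show "{x, y} \<in> ET" using e by simp
    qed
    moreover have "bij_betw (G i) VT (G i ` VT)" using inj by (simp add: bij_betw_def)
    moreover have "G i ` e \<subseteq> G i ` VT" if "e \<in> ET" for e using ET[OF that] by blast
    moreover have "\<forall>x\<in>VT. \<forall>y\<in>VT. {x, y} \<in> ET \<longrightarrow> c {G i x, G i y} = cT {x, y}" using edge by blast
    ultimately show ?thesis
      unfolding copy_in_def H_def prod.case using sub by (intro conjI exI[of _ "G i"]) blast+
  qed
  have "inj_on H {..<p}"
  proof (rule inj_onI)
    fix i j assume "i \<in> {..<p}" "j \<in> {..<p}" "H i = H j"
    \<comment> \<open>The vertex sets for distinct indices are disjoint and, since \<open>VT\<close>
      is nonempty, cannot coincide.\<close>
    then show "i = j" using disj[of i j] VT by (auto simp: H_def)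
  qed
  then have "card (H ` {..<p}) = p" by (simp add: card_image)
  moreover have "disjoint_copies E c VT ET cT U (H ` {..<p})"
    unfolding disjoint_copies_def
  proof (intro conjI pairwiseI ballI)
    fix K L assume "K \<in> H ` {..<p}" "L \<in> H ` {..<p}" "K \<noteq> L"
    then obtain i j where "i < p" "j < p" "i \<noteq> j" "K = H i" "L = H j" by blast
    then show "fst K \<inter> fst L = {}" using disj by (simp add: H_def)
  qed (use copy in blast)
  ultimately show ?thesis by blast
qed

lemma packs_image_card:
  assumes "\<And>i. i < p \<Longrightarrow> colored_embedding E c S F cT U (G i)"
    and "\<And>i j. i < p \<Longrightarrow> j < p \<Longrightarrow> i \<noteq> j \<Longrightarrow> G i ` S \<inter> G j ` S = {}" and S: "finite S"
  shows "card (\<Union>i<p. G i ` S) = p * card S"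
proof -
  have "card (\<Union>i<p. G i ` S) = (\<Sum>i<p. card (G i ` S))"
    using assms by (intro card_UN_disjoint) auto
  also have "\<dots> = (\<Sum>i<p. card S)"
    using assms(1) by (intro sum.cong refl card_image) (auto simp: colored_embedding_def)
  finally show ?thesis by simp
qed

section \<open>Initial packings and greedy packings\<close>

lemma packs_single:
  assumes "p \<le> card U" "finite U"
  shows "packs E c {v} {} cT U p"
proof -
  obtain h where h: "bij_betw h {..<card U} U"
    using assms(2) ex_bij_betw_nat_finite[of U] by (auto simp: atLeast0LessThan)
  then show ?thesis
    unfolding packs_def colored_embedding_def using assms(1)
    by (intro exI[of _ "\<lambda>i _. h i"]) (auto simp: bij_betw_def inj_on_def)
qed

text \<open>Before the last choice at most \<open>(p - 1) * card S\<close> vertices are occupied, so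
  at least \<open>w\<close> remain free and another copy can be found among them.\<close>

lemma packs_greedy:
  assumes found: "\<And>W. W \<subseteq> U \<Longrightarrow> w \<le> card W \<Longrightarrow> \<exists>f. colored_embedding E c S F cT W f"
    and S: "finite S" and U: "finite U" and size: "w + (p - 1) * card S \<le> card U"
  shows "packs E c S F cT U p"
  using size
proof (induction p)
  case (Suc p)
  have "w + (p - 1) * card S \<le> card U"
  proof -
    have "(p - 1) * card S \<le> (Suc p - 1) * card S" by (rule mult_le_mono1) simp
    then show ?thesis using Suc.prems by (meson add_left_mono le_trans)
  qed
  then have "packs E c S F cT U p" by (rule Suc.IH)
  then obtain G where G: "\<forall>i<p. colored_embedding E c S F cT U (G i)"
      "\<forall>i<p. \<forall>j<p. i \<noteq> j \<longrightarrow> G i ` S \<inter> G j ` S = {}"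
    by (rule packsE)
  note emb = G(1)[rule_format] and disj = G(2)[rule_format]
  let ?W = "U - (\<Union>i<p. G i ` S)"
  have "(\<Union>i<p. G i ` S) \<subseteq> U" using emb unfolding colored_embedding_def by blast
  then have "card ?W = card U - p * card S"
    using packs_image_card[OF emb disj S] U by (simp add: card_Diff_subset finite_subset)
  then have "w \<le> card ?W" using Suc.prems by simp
  then obtain f where f: "colored_embedding E c S F cT ?W f" using found[of ?W] by blast
  have "colored_embedding E c S F cT U f" using f by (auto simp: colored_embedding_def)
  moreover have "f ` S \<inter> G i ` S = {}" if "i < p" for i
    using f that by (auto simp: colored_embedding_def)
  ultimately show ?case
    using emb disj
    by (intro packsI[where G = "G(p := f)"]) (simp_all add: less_Suc_eq Int_commute,
        (elim disjE; simp add: Int_commute)+)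
qed (simp add: packs_def)

text \<open>The pool of vertices not used by the copies of the smaller tree has at least as many elements
  as there are copies; Hall's condition with deficiency \<open>x\<close> holds between the attachment vertices
  and the pool because a violating set would yield two sets without an edge between them
  whose cardinalities have product at least \<open>(r + x) * (x + 1)\<close>.\<close>

lemma packs_add_leaf:
  assumes packs: "packs E c S F cT U (r + x)"
    and S: "finite S" "u \<in> S" "v \<notin> S" and F: "\<And>e. e \<in> F \<Longrightarrow> e \<subseteq> S" and U: "finite U"
    and size: "(r + x) * (card S + 1) \<le> card U" and q: "q < real (r + x) * real (x + 1)"
    and mixing: "\<And>A B. A \<subseteq> U \<Longrightarrow> B \<subseteq> U \<Longrightarrow>
      (\<And>a b. a \<in> A \<Longrightarrow> b \<in> B \<Longrightarrow> \<not> ({a, b} \<in> E \<and> c {a, b} = cT {u, v})) \<Longrightarrow>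
      real (card A) * real (card B) \<le> q"
  shows "packs E c (insert v S) (insert {u, v} F) cT U r"
proof -
  let ?p = "r + x"
  obtain G where G: "\<forall>i<?p. colored_embedding E c S F cT U (G i)"
      "\<forall>i<?p. \<forall>j<?p. i \<noteq> j \<longrightarrow> G i ` S \<inter> G j ` S = {}"
    using packs by (rule packsE)
  note emb = G(1)[rule_format] and disj = G(2)[rule_format]
  define Q where "Q = U - (\<Union>i<?p. G i ` S)"
  define N where "N i = {w\<in>Q. {G i u, w} \<in> E \<and> c {G i u, w} = cT {u, v}}" for i
  have used: "(\<Union>i<?p. G i ` S) \<subseteq> U" using emb unfolding colored_embedding_def by blast
  have "card Q = card U - ?p * card S"
    unfolding Q_def using packs_image_card[OF emb disj S(1)] U used
    by (simp add: card_Diff_subset finite_subset)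
  then have Qcard: "?p \<le> card Q" using size by simp
  have finQ: "finite Q" using U by (simp add: Q_def)
  have "\<exists>Y h. Y \<subseteq> {..<?p} \<and> card {..<?p} \<le> card Y + x \<and> inj_on h Y \<and> (\<forall>i\<in>Y. h i \<in> N i)"
  proof (rule hall_deficiency)
    show "finite (N i)" for i using finQ by (simp add: N_def)
    fix I assume I: "I \<subseteq> {..<?p}"
    show "card I \<le> card (\<Union>i\<in>I. N i) + x"
    proof (rule ccontr)
      let ?A = "(\<lambda>i. G i u) ` I" and ?B = "Q - (\<Union>i\<in>I. N i)"
      define t where "t = card (\<Union>i\<in>I. N i)"
      assume "\<not> card I \<le> card (\<Union>i\<in>I. N i) + x"
      then have It: "t + x + 1 \<le> card I" by (simp add: t_def)
      have "card I \<le> ?p" using card_mono[OF _ I] by simp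
      then have t: "t + 1 \<le> r" using It by simp
      have "inj_on (\<lambda>i. G i u) I"
        using disj S(2) I unfolding inj_on_def by (metis disjoint_iff imageI lessThan_iff subsetD)
      then have Acard: "card ?A = card I" by (rule card_image)
      have "card ?B = card Q - t"
        unfolding t_def using finQ by (intro card_Diff_subset) (auto simp: N_def intro: finite_subset)
      then have Bcard: "r + x - t \<le> card ?B" using Qcard by simp
      have "real (card ?A) * real (card ?B) \<le> q"
      proof (rule mixing)
        show "?A \<subseteq> U" using used I S(2) by blast
        show "?B \<subseteq> U" by (auto simp: Q_def)
        show "\<not> ({a, b} \<in> E \<and> c {a, b} = cT {u, v})" if "a \<in> ?A" "b \<in> ?B" for a b
          using that by (auto simp: N_def)
      qed
      moreover have "real (t + x + 1) * real (r + x - t) \<le> real (card ?A) * real (card ?B)"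
        using It Bcard Acard by (intro mult_mono) auto
      \<comment> \<open>The product is concave in \<open>t\<close> with equal values at 0 and
        \<open>r - 1\<close>, so between these it is smallest at the ends.\<close>
      moreover have "real (t + x + 1) * real (r + x - t) = real (r + x) * real (x + 1) + real t * (real r - 1 - real t)"
        using t by (simp add: of_nat_diff algebra_simps)
      moreover have "real t * (real r - 1 - real t) \<ge> 0" using t by simp
      ultimately show False using q by linarith
    qed
  qed simp
  then obtain Y h where Y: "Y \<subseteq> {..<?p}" "r \<le> card Y" and h: "inj_on h Y" "\<And>i. i \<in> Y \<Longrightarrow> h i \<in> N i"
    by auto
  have finY: "finite Y" using Y finite_subset by blast
  \<comment> \<open>The matched copies are renumbered and only the first \<open>r\<close> are kept;
    the vertices of all others become free again.\<close>
  obtain e where e: "bij_betw e {..<card Y} Y"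
    using ex_bij_betw_nat_finite[OF finY] by (auto simp: atLeast0LessThan)
  have eY: "e i \<in> Y" "e i < ?p" if "i < r" for i
    using e Y that by (auto simp: bij_betw_def)
  have einj: "e i \<noteq> e j" if "i < r" "j < r" "i \<noteq> j" for i j
    using e Y that by (auto simp: bij_betw_def inj_on_def)
  define G' where "G' i = (G (e i))(v := h (e i))" for i
  have G'S: "G' i ` S = G (e i) ` S" for i using S(3) by (auto simp: G'_def)
  have G'v: "G' i v = h (e i)" for i by (simp add: G'_def)
  have hQ: "h (e i) \<in> Q" if "i < r" for i using h(2)[OF eY(1)[OF that]] by (simp add: N_def)
  have "colored_embedding E c (insert v S) (insert {u, v} F) cT U (G' i)" if i: "i < r" for i
  proof -
    have emb': "inj_on (G (e i)) S" "G (e i) ` S \<subseteq> U"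
      "\<And>a b. a \<in> S \<Longrightarrow> b \<in> S \<Longrightarrow> {a, b} \<in> F \<Longrightarrow> {G (e i) a, G (e i) b} \<in> E \<and> c {G (e i) a, G (e i) b} = cT {a, b}"
      using emb[OF eY(2)[OF i]] by (auto simp: colored_embedding_def)
    have "G' i v \<notin> G' i ` S" using hQ[OF i] eY(2)[OF i] by (auto simp: G'S G'v Q_def)
    moreover have "inj_on (G' i) S" using emb'(1) S(3) by (auto simp: G'_def inj_on_def)
    ultimately have inj: "inj_on (G' i) (insert v S)" using S(3) by simp
    have edge: "{G (e i) u, h (e i)} \<in> E \<and> c {G (e i) u, h (e i)} = cT {u, v}"
      using h(2)[OF eY(1)[OF i]] by (simp add: N_def)
    have "{G' i a, G' i b} \<in> E \<and> c {G' i a, G' i b} = cT {a, b}"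
      if ab: "a \<in> insert v S" "b \<in> insert v S" "{a, b} \<in> insert {u, v} F" for a b
    proof (cases "{a, b} = {u, v}")
      case True
      then have "{G' i a, G' i b} = {G (e i) u, h (e i)}"
        using S(2,3) by (auto simp: doubleton_eq_iff G'_def)
      then show ?thesis using edge True by simp
    next
      case False
      then have "{a, b} \<in> F" "a \<in> S" "b \<in> S" using ab F by blast+
      then show ?thesis using emb'(3)[of a b] S(3) by (auto simp: G'_def)
    qed
    moreover have "G' i ` insert v S \<subseteq> U"
      using emb'(2) hQ[OF i] by (auto simp: G'S[of i] G'v Q_def)
    ultimately show ?thesis using inj unfolding colored_embedding_def by blast
  qed
  moreover have "G' i ` insert v S \<inter> G' j ` insert v S = {}" if ij: "i < r" "j < r" "i \<noteq> j" for i j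
  proof -
    have "G (e i) ` S \<inter> G (e j) ` S = {}" using disj eY(2) einj ij by blast
    moreover have "h (e i) \<noteq> h (e j)" using h(1) eY(1) einj ij by (meson inj_onD)
    moreover have "h (e i) \<notin> G (e j) ` S" "h (e j) \<notin> G (e i) ` S"
      using hQ ij eY(2) by (auto simp: Q_def)
    ultimately show ?thesis unfolding image_insert G'S G'v by simp
  qed
  ultimately show ?thesis by (rule packsI)
qed

text \<open>Every leaf costs \<open>x\<close> copies, so the count falls from
  \<open>P + (m - 1) * x\<close> single vertices to \<open>P\<close> copies of a tree with
  \<open>m\<close> vertices. Instance \<open>j\<close> of the size hypothesis keeps at least as many
  free vertices as copies while the tree has \<open>j\<close> vertices.\<close>

lemma packs_leaf_built:
  assumes "leaf_built S F" and "card S \<le> m" and "\<And>e. e \<in> F \<Longrightarrow> cT e \<in> D" and U: "finite U"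
    and size: "\<And>j. j < m \<Longrightarrow> (P + (m - j) * x) * (j + 1) \<le> card U"
    and q: "q < real (P + x) * real (x + 1)"
    and mixing: "\<And>A B k. k \<in> D \<Longrightarrow> A \<subseteq> U \<Longrightarrow> B \<subseteq> U \<Longrightarrow>
      (\<And>a b. a \<in> A \<Longrightarrow> b \<in> B \<Longrightarrow> \<not> ({a, b} \<in> E \<and> c {a, b} = k)) \<Longrightarrow>
      real (card A) * real (card B) \<le> q"
  shows "packs E c S F cT U (P + (m - card S) * x)"
  using assms(1-3)
proof (induction rule: leaf_built.induct)
  case (single v)
  have "P + (m - 1) * x \<le> (P + (m - 0) * x) * (0 + 1)" by simp
  also have "\<dots> \<le> card U" using size[of 0] single by simp
  finally show ?case using U by (simp add: packs_single)
next
  case (leaf S F u v)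
  have S: "finite S" "\<forall>e\<in>F. e \<subseteq> S" using leaf_built_finite[OF leaf.hyps(1)] by auto
  have cS: "card (insert v S) = Suc (card S)" using S leaf.hyps by simp
  then have lt: "card S < m" using leaf.prems by simp
  then obtain s where s: "m = card S + Suc s" using less_imp_Suc_add by fastforce
  let ?r = "P + s * x"
  have p: "P + (m - card S) * x = ?r + x" using s by simp
  have "packs E c (insert v S) (insert {u, v} F) cT U ?r"
  proof (rule packs_add_leaf[OF _ S(1) leaf.hyps(2,3) _ U])
    show "packs E c S F cT U (?r + x)" using leaf.IH leaf.prems lt unfolding p by simp
    show "(?r + x) * (card S + 1) \<le> card U" using size[OF lt] unfolding p .
    \<comment> \<open>The condition on \<open>q\<close> is hardest at the last leaf, where only
      \<open>P + x\<close> copies are extended.\<close>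
    have "real (P + x) * real (x + 1) \<le> real (?r + x) * real (x + 1)"
      by (intro mult_right_mono) auto
    then show "q < real (?r + x) * real (x + 1)" using q by linarith
    show "real (card A) * real (card B) \<le> q" if "A \<subseteq> U" "B \<subseteq> U"
      "\<And>a b. a \<in> A \<Longrightarrow> b \<in> B \<Longrightarrow> \<not> ({a, b} \<in> E \<and> c {a, b} = cT {u, v})" for A B
      using mixing[of "cT {u, v}" A B] that leaf.prems by blast
  qed (use S in auto)
  moreover have "m - card (insert v S) = s" using s cS by simp
  ultimately show ?case by simp
qed

text \<open>With \<open>M = u div m\<close> the uniform loss \<open>x\<close> is the integer part of \<open>\<mu> - (u mod m) / m\<close>, the
  largest value compatible with the claimed number \<open>M - x\<close> of copies.\<close>

lemma packing_parameters:
  fixes u m :: nat and \<mu> :: real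
  assumes m: "m \<ge> 3" and \<mu>: "\<mu> \<ge> 1" and u: "real u \<ge> real m * (real m - 1) * \<mu>"
  obtains x where "(m - 1) * x \<le> u div m" and "\<mu>\<^sup>2 < real (u div m) * real (x + 1)"
    and "real (u div m) - real x \<ge> real u / real m - \<mu>"
proof
  define M where "M = real (u div m)"
  define \<rho> where "\<rho> = real (u mod m) / real m"
  define x where "x = nat \<lfloor>\<mu> - \<rho>\<rfloor>"
  have \<rho>: "\<rho> \<ge> 0" "\<rho> \<le> 1 - 1 / real m"
  proof -
    have "u mod m + 1 \<le> m" using m by (simp add: Suc_leI)
    then have "real (u mod m) + 1 \<le> real m" by linarith
    then show "\<rho> \<le> 1 - 1 / real m" using m by (simp add: \<rho>_def field_simps)
  qed (simp add: \<rho>_def)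
  have \<rho>1: "\<rho> < 1" using \<rho>(2) m by (smt (verit) divide_pos_pos of_nat_0_less_iff not_numeral_le_zero gr0I)
  have "real u = real m * M + real (u mod m)"
    unfolding M_def by (metis mult_div_mod_eq of_nat_add of_nat_mult)
  then have uM: "real u / real m = M + \<rho>" using m by (simp add: \<rho>_def field_simps)
  have "(real m - 1) * \<mu> \<le> real u / real m" using u m by (simp add: field_simps)
  then have M: "M \<ge> (real m - 1) * \<mu> - \<rho>" using uM by linarith
  have x: "real x \<le> \<mu> - \<rho>" "\<mu> - \<rho> < real x + 1"
    unfolding x_def using \<mu> \<rho>1 by (auto simp: of_nat_floor)
  have "real ((m - 1) * x) \<le> real (u div m)"
  proof -
    have "real ((m - 1) * x) = (real m - 1) * real x" using m by (simp add: of_nat_diff)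
    also have "\<dots> \<le> (real m - 1) * (\<mu> - \<rho>)" using x m by (intro mult_left_mono) auto
    also have "\<dots> \<le> (real m - 1) * \<mu> - \<rho>"
      using mult_right_mono[of 1 "real m - 1" \<rho>] \<rho> m by (simp add: algebra_simps)
    finally show ?thesis using M by (simp add: M_def)
  qed
  then show "(m - 1) * x \<le> u div m" by (simp only: of_nat_le_iff)
  show "real (u div m) - real x \<ge> real u / real m - \<mu>"
    using uM x(1) by (simp add: M_def)
  have M1: "M \<le> M * (real x + 1)" by (simp add: M_def algebra_simps)
  have "\<mu>\<^sup>2 < M * (real x + 1)"
  \<comment> \<open>The factors satisfy \<open>M \<ge> (m - 1) * \<mu> - \<rho>\<close> and
    \<open>x + 1 > \<mu> - \<rho>\<close>. The product of these bounds suffices for large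
    \<open>\<mu>\<close>; for small \<open>\<mu>\<close> the bound \<open>M1\<close> does. For
    \<open>m = 3\<close> a gap remains between the two ranges, closed by the integrality of
    \<open>M\<close> and \<open>x\<close>.\<close>
  proof (cases "m = 3")
    case False
    then have "(real m - 1) * \<mu> \<ge> 3 * \<mu>" using m \<mu> by (intro mult_right_mono) auto
    then have M3: "M \<ge> 3 * \<mu> - \<rho>" using M by linarith
    show ?thesis
    proof (cases "\<mu> \<ge> 2")
      case True
      have "(3 * \<mu> - \<rho>) * (\<mu> - \<rho>) < M * (real x + 1)"
        using M3 x \<mu> \<rho>1 by (intro mult_le_less_imp_less) auto
      moreover have "2 * \<mu> * (\<mu> - 2 * \<rho>) \<ge> 0" using True \<rho>1 by simp
      then have "\<mu>\<^sup>2 \<le> (3 * \<mu> - \<rho>) * (\<mu> - \<rho>)"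
      proof -
        have "(3 * \<mu> - \<rho>) * (\<mu> - \<rho>) = \<mu>\<^sup>2 + 2 * \<mu> * (\<mu> - 2 * \<rho>) + \<rho>\<^sup>2"
          by (simp add: power2_eq_square algebra_simps)
        then show ?thesis using \<open>2 * \<mu> * (\<mu> - 2 * \<rho>) \<ge> 0\<close> by simp
      qed
      ultimately show ?thesis by linarith
    next
      case False
      then have "(\<mu> - 1) * (2 - \<mu>) \<ge> 0" using \<mu> by simp
      then have "\<mu>\<^sup>2 \<le> 3 * \<mu> - 2" by (simp add: power2_eq_square algebra_simps)
      then show ?thesis using M3 M1 \<rho>1 by linarith
    qed
  next
    case True
    then have M2: "M \<ge> 2 * \<mu> - \<rho>" and \<rho>2: "\<rho> \<le> 2 / 3" using M \<rho>(2) by auto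
    \<comment> \<open>The product bound with \<open>\<rho> = 2 / 3\<close> exceeds mu^2 by mu^2 - 2
      mu + 4/9, whose larger root 1 + sqrt 5 / 3 lies just below 7/4.\<close>
    consider "\<mu> \<ge> 7 / 4" | "3 / 2 \<le> \<mu>" "\<mu> < 7 / 4" | "\<mu> < 3 / 2" by linarith
    then show ?thesis
    proof cases
      case 1
      have "(2 * \<mu> - 2 / 3) * (\<mu> - 2 / 3) < M * (real x + 1)"
        using M2 x 1 \<rho>2 by (intro mult_le_less_imp_less) auto
      moreover have "(\<mu> - 7 / 4) * (\<mu> - 1 / 4) \<ge> 0" using 1 by simp
      then have "\<mu>\<^sup>2 \<le> (2 * \<mu> - 2 / 3) * (\<mu> - 2 / 3)"
      proof -
        have "(2 * \<mu> - 2 / 3) * (\<mu> - 2 / 3) = \<mu>\<^sup>2 + (\<mu> - 7 / 4) * (\<mu> - 1 / 4) + 1 / 144"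
          by (simp add: power2_eq_square field_simps)
        then show ?thesis using \<open>(\<mu> - 7 / 4) * (\<mu> - 1 / 4) \<ge> 0\<close> by linarith
      qed
      ultimately show ?thesis by linarith
    next
      case 2
      \<comment> \<open>The lower bound for this integer is at least 7/3.\<close>
      have "u div m \<ge> 3"
        using M2 2 \<rho>2 unfolding M_def by linarith
      then have M3: "M \<ge> 3" by (simp add: M_def)
      show ?thesis
      proof (cases "\<mu>\<^sup>2 < 3")
        case True
        then show ?thesis using M3 M1 by linarith
      next
        case False
        \<comment> \<open>17/10 lies below sqrt 3 and above 5/3; the latter makes
          \<open>\<mu> - \<rho>\<close> exceed 1, which forces \<open>x \<ge> 1\<close>.\<close>
        then have "\<mu> \<ge> 17 / 10"
          using power_strict_mono[of \<mu> "17 / 10" 2] \<mu> by (force simp: power2_eq_square)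
        then have "x \<ge> 1" using x(2) \<rho>2 by linarith
        then have "3 * 2 \<le> M * (real x + 1)" using M3 by (intro mult_mono) auto
        moreover have "\<mu>\<^sup>2 < 6"
          using power_strict_mono[of \<mu> "7 / 4" 2] 2 \<mu> by (simp add: power2_eq_square)
        ultimately show ?thesis by linarith
      qed
    next
      case 3
      then have "(\<mu> - 1) * (3 / 2 - \<mu>) \<ge> 0" using \<mu> by simp
      moreover have "5 / 2 * \<mu> - 3 / 2 = \<mu>\<^sup>2 + (\<mu> - 1) * (3 / 2 - \<mu>)"
        by (simp add: power2_eq_square field_simps)
      ultimately have "\<mu>\<^sup>2 \<le> 5 / 2 * \<mu> - 3 / 2" by linarith
      then show ?thesis using M2 M1 \<rho>2 3 by linarith
    qed
  qed
  then show "\<mu>\<^sup>2 < real (u div m) * real (x + 1)" by (simp add: M_def add.commute)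
qed

text \<open>Mixing with \<open>A = B = W\<close> shows that every set \<open>W\<close> of more than
  \<open>\<mu>\<close> vertices contains an edge of the required color, so edges can be removed
  greedily.\<close>

lemma packs_edge:
  assumes U: "finite U" and E: "\<And>e. e \<in> E \<Longrightarrow> card e = 2" and vw: "v \<noteq> w" and \<mu>: "\<mu> \<ge> 1"
    and mixing: "\<And>A B. A \<subseteq> U \<Longrightarrow> B \<subseteq> U \<Longrightarrow>
      (\<And>a b. a \<in> A \<Longrightarrow> b \<in> B \<Longrightarrow> \<not> ({a, b} \<in> E \<and> c {a, b} = cT {v, w})) \<Longrightarrow>
      real (card A) * real (card B) \<le> \<mu>\<^sup>2"
  obtains p where "packs E c {v, w} {{v, w}} cT U p" and "real p \<ge> real (card U) / 2 - \<mu>"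
proof (cases "real (card U) / 2 \<le> \<mu>")
  case True
  then show ?thesis using that[of 0] by (simp add: packs_def)
next
  case False
  define p where "p = nat \<lceil>real (card U) / 2 - \<mu>\<rceil>"
  have p: "real p \<ge> real (card U) / 2 - \<mu>" "real p < real (card U) / 2 - \<mu> + 1" "p \<ge> 1"
    unfolding p_def using False by linarith+
  \<comment> \<open>The least integer above \<open>\<mu>\<close>.\<close>
  define s where "s = nat \<lfloor>\<mu>\<rfloor> + 1"
  have s: "real s > \<mu>" "real s \<le> \<mu> + 1" unfolding s_def using \<mu> by linarith+
  have "packs E c {v, w} {{v, w}} cT U p"
  proof (rule packs_greedy)
    fix W assume W: "W \<subseteq> U" "s \<le> card W"
    have "real (card W) > \<mu>" using W(2) s(1) by linarith
    then have "real (card W) * real (card W) > \<mu>\<^sup>2"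
      unfolding power2_eq_square using \<mu> by (intro mult_strict_mono) auto
    then obtain a b where ab: "a \<in> W" "b \<in> W" "{a, b} \<in> E" "c {a, b} = cT {v, w}"
      using mixing[of W W] W by (meson not_le)
    have "a \<noteq> b" using E[OF ab(3)] by auto
    then show "\<exists>f. colored_embedding E c {v, w} {{v, w}} cT W f"
      using ab vw unfolding colored_embedding_def
      by (intro exI[of _ "\<lambda>z. if z = v then a else b"]) (auto simp: insert_commute)
  next
    \<comment> \<open>The left side is less than \<open>card U - 2 * \<mu> + (\<mu> + 1)\<close>,
      and \<open>\<mu> \<ge> 1\<close> absorbs the rounding.\<close>
    have "real (s + (p - 1) * card {v, w}) \<le> real (card U)"
      using vw p s \<mu> by (simp add: of_nat_diff)
    then show "s + (p - 1) * card {v, w} \<le> card U" by (simp only: of_nat_le_iff)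
  qed (use U in auto)
  then show ?thesis using that p by blast
qed

theorem theorem1p8:
  fixes V :: "'v set" and E :: "'v set set" and c :: "'v set \<Rightarrow> 'c" and D :: "'c set"
    and n d m :: nat and l :: real
    and VT :: "'t set" and ET :: "'t set set" and cT :: "'t set \<Rightarrow> 'c"
    and U :: "'v set"
  assumes "ndl_colored_graph V E c D n d l"
    and "d > 0" and "l \<ge> 0"
    and "tree_graph VT ET" and "edge_colored_graph VT ET cT D" and "card VT = m"
    and "U \<subseteq> V"
    and "real (card U) \<ge> real m * (real m - 1) * (l * real n / real d)"
  shows "\<exists>\<C>. finite \<C> \<and> disjoint_copies E c VT ET cT U \<C> \<and>
           real (card \<C>) \<ge> real (card U) / real m - l * real n / real d"
proof -
  define \<mu> where "\<mu> = l * real n / real d"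
  have \<mu>0: "\<mu> \<ge> 0" using assms(2,3) by (simp add: \<mu>_def)
  have VE: "finite V" "\<And>e. e \<in> E \<Longrightarrow> card e = 2"
    using assms(1) unfolding ndl_colored_graph_def edge_colored_graph_def simple_graph_def by auto
  have U: "finite U" using VE(1) assms(7) finite_subset by blast
  have ET: "\<And>e. e \<in> ET \<Longrightarrow> e \<subseteq> VT \<and> card e = 2" and cT: "\<And>e. e \<in> ET \<Longrightarrow> cT e \<in> D"
    using assms(5) unfolding edge_colored_graph_def simple_graph_def by auto
  have built: "leaf_built VT ET" by (rule tree_graph_leaf_built[OF assms(4)])
  then have VT: "VT \<noteq> {}" "finite VT" using leaf_built_finite by auto
  have mixing: "real (card A) * real (card B) \<le> \<mu>\<^sup>2"
    if "k \<in> D" "A \<subseteq> U" "B \<subseteq> U"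
      "\<And>a b. a \<in> A \<Longrightarrow> b \<in> B \<Longrightarrow> \<not> ({a, b} \<in> E \<and> c {a, b} = k)" for k A B
    unfolding \<mu>_def
  proof (rule ndl_graph_mixing[OF _ assms(2,3)])
    show "ndl_graph V {e\<in>E. c e = k} n d l"
      using assms(1) that(1) unfolding ndl_colored_graph_def by blast
  qed (use that assms(7) in auto)
  \<comment> \<open>No vertex is joined to itself, so mixing applies to a singleton paired with
    itself.\<close>
  have \<mu>1: "\<mu> \<ge> 1" if k: "k \<in> D" and u: "u \<in> U" for k u
  proof -
    have "{u, u} \<notin> E" using VE(2)[of "{u, u}"] by auto
    then have "real (card {u}) * real (card {u}) \<le> \<mu>\<^sup>2"
      using u by (intro mixing[OF k]) auto
    then show ?thesis using \<mu>0 power2_le_imp_le[of 1 \<mu>] by simp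
  qed
  have "\<exists>p. packs E c VT ET cT U p \<and> real p \<ge> real (card U) / real m - \<mu>"
  proof (cases "U = {}")
    case True
    then show ?thesis using \<mu>0 by (intro exI[of _ 0]) (simp add: packs_def)
  next
    case False
    then obtain u0 where u0: "u0 \<in> U" by blast
    show ?thesis
      using built
    proof cases
      case (single v)
      then have "m = 1" using assms(6) by simp
      moreover have "packs E c VT ET cT U (card U)" using single U by (simp add: packs_single)
      ultimately show ?thesis using \<mu>0 by (intro exI[of _ "card U"]) simp
    next
      case (leaf S F u v)
      then have "cT {u, v} \<in> D" using cT by blast
      note \<mu> = \<mu>1[OF this u0]
      have m: "m = Suc (card S)" and S: "finite S"
        using leaf VT assms(6) by auto
      show ?thesis
      proof (cases "m = 2")
        case True
        then have "card S = 1" using m by simp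
        then have "S = {u}" using leaf by (metis card_1_singletonE singletonD)
        moreover have "F = {}"
          using ET leaf \<open>S = {u}\<close> leaf_built_finite[OF leaf(3)]
          by (fastforce simp: subset_singleton_iff)
        ultimately have T: "VT = {u, v}" "ET = {{u, v}}" "u \<noteq> v" using leaf by auto
        obtain p where "packs E c {u, v} {{u, v}} cT U p" "real p \<ge> real (card U) / 2 - \<mu>"
          by (rule packs_edge[OF U VE(2) T(3) \<mu> mixing[OF \<open>cT {u, v} \<in> D\<close>]])
        then show ?thesis using T True by auto
      next
        case False
        have "S \<noteq> {}" using leaf by blast
        then have m3: "m \<ge> 3" using False m S by (cases "card S") auto
        obtain x where x: "(m - 1) * x \<le> card U div m" "\<mu>\<^sup>2 < real (card U div m) * real (x + 1)"
          "real (card U div m) - real x \<ge> real (card U) / real m - \<mu>"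
          using packing_parameters[OF m3 \<mu>, of "card U"] assms(8) unfolding \<mu>_def by blast
        define P where "P = card U div m - x"
        \<comment> \<open>Ensures that the natural subtraction in \<open>P\<close> is exact:
          \<open>card U div m\<close> copies enter the last stage and \<open>P\<close> leave
          it.\<close>
        have "x \<le> (m - 1) * x" using m3 by (auto simp: Suc_le_eq)
        also note x(1)
        finally have P: "P + x = card U div m" by (simp add: P_def)
        have "packs E c VT ET cT U (P + (m - card VT) * x)"
        proof (rule packs_leaf_built[OF built _ cT U _ _ mixing])
          show "\<mu>\<^sup>2 < real (P + x) * real (x + 1)" using x(2) P by simp
          fix j assume "j < m"
          then obtain s where s: "m = j + 1 + s" using less_imp_Suc_add by fastforce
          \<comment> \<open>The \<open>s * x\<close> extra copies must fit into the \<open>s\<close>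
            vertices by which \<open>j + 1\<close> falls short of \<open>m\<close>, counted
            \<open>P + x\<close> times. For \<open>s > 0\<close> this follows from
            \<open>j + 1 \<le> m - 1\<close>, which fails at \<open>s = 0\<close>.\<close>
          have "s * ((j + 1) * x) \<le> s * (P + x)"
          proof (cases "s = 0")
            case False
            then have "(j + 1) * x \<le> (m - 1) * x" using s by (intro mult_le_mono1) simp
            then show ?thesis using x(1) P by (intro mult_le_mono2) simp
          qed simp
          then have "(P + x + s * x) * (j + 1) \<le> (P + x) * m" by (simp add: s algebra_simps)
          also have "\<dots> \<le> card U" unfolding P by simp
          finally show "(P + (m - j) * x) * (j + 1) \<le> card U" by (simp add: s algebra_simps)
        qed (use assms(6) in auto)
        then have "packs E c VT ET cT U P" using assms(6) by simp
        moreover have "real P \<ge> real (card U) / real m - \<mu>"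
          using x(3) P by linarith
        ultimately show ?thesis by blast
      qed
    qed
  qed
  then obtain p where p: "packs E c VT ET cT U p" "real p \<ge> real (card U) / real m - \<mu>" by blast
  show ?thesis
    using packs_disjoint_copies[OF p(1) VT(1) ET] p(2) unfolding \<mu>_def by auto
qed

end
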